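(* Consider the Heston model with stochastic interest rates described in the context and let $h=T/n$, $n\in\mathbb{N}^+$. Suppose Assumption 1 holds. Then for every $q\ge2$, \[ \mathbb{E}\left[\left|X_T-\hat X^h_T\right|^q\right]=O(h^q)\quad\text{as } h\to0. \]
   Context: On a filtered probability space, let $W^1,W^2,W^3$ be Brownian motions with $W^1,W^2$ independent and $W^3$ independent of $(W^1,W^2)$. The model is $\mathrm{d}S_t=r_tS_t\,\mathrm{d}t+\sqrt{V_t}S_t(\rho\,\mathrm{d}W^1_t+\sqrt{1-\rho^2}\,\mathrm{d}W^2_t)$, $\mathrm{d}V_t=k(\theta-V_t)\,\mathrm{d}t+\sigma\sqrt{V_t}\,\mathrm{d}W^1_t$, $\mathrm{d}r_t=\mu(t,r_t)\,\mathrm{d}t+\phi(t,r_t)\,\mathrm{d}W^3_t$, with $k,\theta,\sigma>0$, $\rho\in[-1,1]$, $S_0,V_0>0$, $\mu,\phi:[0,T]\times\mathbb{R}\to\mathbb{R}$ continuous and the $r$-equation having a unique solution. Set $X_t=\ln S_t$; then $X_T=X_0+\int_0^Tr_t\,\mathrm{d}t+\left(\frac{\rho k}{\sigma}-\frac12\right)\int_0^TV_t\,\mathrm{d}t+\frac{\rho}{\sigma}(V_T-V_0-k\theta T)+\sqrt{1-\rho^2}\sqrt{\int_0^TV_t\,\mathrm{d}t}\,N$, where $N$ is a standard normal random variable independent of $(V_t)$ and $(r_t)$. Given an approximation $(\hat r_{ih})_{i}$ of $(r_{ih})_i$ (with $\hat r_0=r_0$) and the exact values $V_{ih}$, the scheme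 is $\hat X^h_T=X_0+\sum_{i=0}^{T/h-1}\hat r_{ih}h+\left(\frac{\rho k}{\sigma}-\frac12\right)\sum_{i=0}^{T/h-1}V_{ih}h+\frac{\rho}{\sigma}(V_T-V_0-k\theta T)+\sqrt{1-\rho^2}\sqrt{\sum_{i=0}^{T/h-1}V_{ih}h}\,N$ with the same $N$, and $\hat S^h_T=e^{\hat X^h_T}$. Assumption 1: for every $q\ge 1$, $\sup_{t\in[0,T]}\mathbb{E}[|\mu(t,r_t)|^q]<\infty$, $\sup_{t\in[0,T]}\mathbb{E}[|\phi(t,r_t)|^q]<\infty$, and there is $c_q$ independent of $h$ with $\max_{i=1,\dots,T/h}\mathbb{E}[|\hat r_{ih}-r_{ih}|^q]<c_qh^q$. *)

theory Defs
  imports "HOL-Probability.Probability"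
begin

definition is_filtration :: "'a measure \<Rightarrow> (real \<Rightarrow> 'a measure) \<Rightarrow> bool" where
  "is_filtration M F \<longleftrightarrow> (\<forall>t. subalgebra M (F t)) \<and>
     (\<forall>s t. s \<le> t \<longrightarrow> sets (F s) \<subseteq> sets (F t))"

definition adapted_proc :: "(real \<Rightarrow> 'a measure) \<Rightarrow> real \<Rightarrow> (real \<Rightarrow> 'a \<Rightarrow> real) \<Rightarrow> bool" where
  "adapted_proc F T X \<longleftrightarrow> (\<forall>t\<in>{0..T}. X t \<in> borel_measurable (F t))"

definition cont_paths :: "'a measure \<Rightarrow> real \<Rightarrow> (real \<Rightarrow> 'a \<Rightarrow> real) \<Rightarrow> bool" where
  "cont_paths M T X \<longleftrightarrow> (\<forall>\<omega>\<in>space M. continuous_on {0..T} (\<lambda>t. X t \<omega>))"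

definition gen_sigma :: "'a measure \<Rightarrow> ('a \<Rightarrow> real) set \<Rightarrow> 'a set set" where
  "gen_sigma M Xs = sigma_sets (space M) {X -` B \<inter> space M | X B. X \<in> Xs \<and> B \<in> sets borel}"

definition is_BM :: "'a measure \<Rightarrow> (real \<Rightarrow> 'a measure) \<Rightarrow> real \<Rightarrow> (real \<Rightarrow> 'a \<Rightarrow> real) \<Rightarrow> bool" where
  "is_BM M F T W \<longleftrightarrow> adapted_proc F T W \<and> cont_paths M T W \<and>
     (\<forall>\<omega>\<in>space M. W 0 \<omega> = 0) \<and>
     (\<forall>s t. 0 \<le> s \<and> s < t \<and> t \<le> T \<longrightarrow>
        distributed M lborel (\<lambda>\<omega>. W t \<omega> - W s \<omega>) (normal_density 0 (sqrt (t - s))) \<and>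
        prob_space.indep_set M (sets (F s)) (gen_sigma M {\<lambda>\<omega>. W t \<omega> - W s \<omega>}))"

text \<open>Ito integral (for continuous adapted integrands): I is the stochastic integral of H
  against W over [a,b] iff the left-point Riemann sums along the uniform partitions
  converge to I in probability.\<close>
definition ito_integral_is :: "'a measure \<Rightarrow> (real \<Rightarrow> 'a \<Rightarrow> real) \<Rightarrow> (real \<Rightarrow> 'a \<Rightarrow> real)
    \<Rightarrow> real \<Rightarrow> real \<Rightarrow> ('a \<Rightarrow> real) \<Rightarrow> bool" where
  "ito_integral_is M H W a b I \<longleftrightarrow>
     (\<forall>\<epsilon>>0. (\<lambda>n::nat. measure M {\<omega>\<in>space M.
        \<bar>(\<Sum>j<n. H (a + real j * (b - a) / real n) \<omega> *
              (W (a + real (Suc j) * (b - a) / real n) \<omega> - W (a + real j * (b - a) / real n) \<omega>))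
          - I \<omega>\<bar> > \<epsilon>}) \<longlonglongrightarrow> 0)"

definition sde_solution :: "'a measure \<Rightarrow> (real \<Rightarrow> 'a measure) \<Rightarrow> real \<Rightarrow>
    (real \<Rightarrow> real \<Rightarrow> real) \<Rightarrow> (real \<Rightarrow> real \<Rightarrow> real) \<Rightarrow> (real \<Rightarrow> 'a \<Rightarrow> real)
    \<Rightarrow> (real \<Rightarrow> 'a \<Rightarrow> real) \<Rightarrow> bool" where
  "sde_solution M F T b s W X \<longleftrightarrow> adapted_proc F T X \<and> cont_paths M T X \<and>
     (\<forall>t\<in>{0..T}. ito_integral_is M (\<lambda>u \<omega>. s u (X u \<omega>)) W 0 t
         (\<lambda>\<omega>. X t \<omega> - X 0 \<omega> - integral {0..t} (\<lambda>u. b u (X u \<omega>))))"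

end

theory Submission
  imports Defs
begin

text \<open>
  The error is split into the quadrature errors of \<open>r\<close> and \<open>V\<close>, the approximation error of \<open>r\<close>, and
  the error of the square root multiplying \<open>N\<close>. It suffices to bound even moments by \<open>C h\<^sup>2\<^sup>m\<close>.

  For a quadrature error, refine the grid. The difference between the fine and the coarse Riemann sum
  is a combination of increments with deterministic weights of size at most \<open>h\<close>. Its noise part is a limit
  in probability of discrete martingale transforms, whose even moments obey a discrete Gronwall
  recursion, and Fatou's lemma passes the bound to the limit.
  The moments of \<open>V\<close> themselves come from the same estimate localised to \<open>V \<le> L\<close>.

  For the square root, \<open>\<bar>sqrt a - sqrt b\<bar> \<le> \<bar>a - b\<bar> / sqrt a\<close>, where \<open>a = \<integral> V\<close> has all negative moments because
  \<open>V\<close> starts at \<open>V0 > 0\<close> and all moments of \<open>V\<^sub>t - V0\<close> are small for small \<open>t\<close>.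
\<close>

subsection \<open>Riemann sums, moments and convergence in probability\<close>

text \<open>The noise is what threatens the order: within one cell it moves a path by order
  \<open>sqrt h\<close>, so adding the cell errors in absolute value would give order one half only.
  Order one is due to cancellation between cells, whose noise errors are orthogonal. A stochastic
  integral is given here only as a limit in probability of left-point sums on uniform partitions and
  does not come with an isometry; so every estimate is proved for finite sums of products of a
  past-measurable factor and a Gaussian increment, with constants independent of the number of
  summands. Moments are nonnegative extended integrals, which lets Fatou apply before any
  integrability is known. For r the moments of the coefficients are part of Assumption 1; for V they
  have to be derived. Nothing keeps V away from 0, where the square root is not Lipschitz; the way
  out is that only the whole integral of V must not be small, and its size is controlled from below
  by the behaviour of V near time 0.\<close>

lemma integral_uniform_partition:
  fixes f :: "real \<Rightarrow> real"
  assumes f: "continuous_on {0..t} f" and h: "0 \<le> h" "real k * h \<le> t"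
  shows "integral {0..real k * h} f = (\<Sum>i<k. integral {real i * h..real (Suc i) * h} f)"
  using h(2)
proof (induction k)
  case 0
  then show ?case by simp
next
  case (Suc k)
  have le: "real k * h \<le> real (Suc k) * h"
    using h(1) by (simp add: algebra_simps)
  have "f integrable_on {0..real (Suc k) * h}"
    using Suc.prems by (intro integrable_continuous_real continuous_on_subset[OF f]) auto
  then have "integral {0..real (Suc k) * h} f
      = integral {0..real k * h} f + integral {real k * h..real (Suc k) * h} f"
    using h(1) le by (intro Henstock_Kurzweil_Integration.integral_combine[symmetric]) auto
  then show ?case
    using Suc le by simp
qed

lemma riemann_sum_tendsto:
  fixes f :: "real \<Rightarrow> real"
  assumes f: "continuous_on {0..t} f" and t: "0 \<le> t"
  shows "(\<lambda>n. \<Sum>i<n. f (real i * (t / real n)) * (t / real n)) \<longlonglongrightarrow> integral {0..t} f"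
proof (rule LIMSEQ_I)
  fix e :: real assume e: "e > 0"
  \<comment> \<open>Dividing by \<open>t + 1\<close> instead of \<open>t\<close> also covers
    \<open>t = 0\<close> and gives \<open>e' * t < e\<close>.\<close>
  define e' where "e' = e / (t + 1)"
  have e': "e' > 0" using e t by (simp add: e'_def)
  have "uniformly_continuous_on {0..t} f"
    using f by (intro compact_uniformly_continuous) auto
  then obtain d where d: "d > 0" "\<And>x y. x \<in> {0..t} \<Longrightarrow> y \<in> {0..t} \<Longrightarrow> \<bar>y - x\<bar> < d \<Longrightarrow> \<bar>f y - f x\<bar> < e'"
    unfolding uniformly_continuous_on_def using e' by (fastforce simp: dist_real_def)
  obtain n0 :: nat where n0: "real n0 > t / d" using reals_Archimedean2 by blast
  show "\<exists>no. \<forall>n\<ge>no. norm ((\<Sum>i<n. f (real i * (t / real n)) * (t / real n)) - integral {0..t} f) < e"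
  proof (intro exI[of _ "Suc n0"] allI impI)
    fix n assume n: "n \<ge> Suc n0"
    define h where "h = t / real n"
    have n_pos: "real n > 0" using n by simp
    have h: "0 \<le> h" "real n * h = t" using n_pos t by (auto simp: h_def)
    have "t / d < real n" using n0 n by simp
    then have hd: "h < d"
      using n_pos d(1) by (simp add: h_def field_simps)
    have cell: "\<bar>f (real i * h) * h - integral {real i * h..real (Suc i) * h} f\<bar> \<le> e' * h" if i: "i < n" for i
    proof -
      have len: "real (Suc i) * h = real i * h + h" by (simp add: algebra_simps)
      have "real (Suc i) * h \<le> real n * h" using i h by (intro mult_right_mono) auto
      then have sub: "{real i * h..real (Suc i) * h} \<subseteq> {0..t}"
        using h by auto
      then have cont: "continuous_on {real i * h..real (Suc i) * h} f"
        using f continuous_on_subset by blast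
      have mem: "real i * h \<in> {0..t}" using sub len h(1) by auto
      have "norm (integral {real i * h..real (Suc i) * h} (\<lambda>x. f x - f (real i * h)))
          \<le> e' * (real (Suc i) * h - real i * h)"
      proof (rule integral_bound)
        show "continuous_on {real i * h..real (Suc i) * h} (\<lambda>x. f x - f (real i * h))"
          using cont by (intro continuous_intros)
        fix x assume x: "x \<in> {real i * h..real (Suc i) * h}"
        then have "\<bar>x - real i * h\<bar> < d" using hd len by auto
        then show "norm (f x - f (real i * h)) \<le> e'"
          using d(2)[OF mem, of x] x sub by (force simp: less_imp_le)
      qed (use len h in auto)
      also have "integral {real i * h..real (Suc i) * h} (\<lambda>x. f x - f (real i * h))
          = integral {real i * h..real (Suc i) * h} f - f (real i * h) * h"
        using len h(1) integrable_continuous_real[OF cont] by (subst integral_diff) auto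
      finally show ?thesis using len by (simp add: abs_minus_commute)
    qed
    have "\<bar>(\<Sum>i<n. f (real i * h) * h) - integral {0..t} f\<bar>
        = \<bar>\<Sum>i<n. (f (real i * h) * h - integral {real i * h..real (Suc i) * h} f)\<bar>"
      using integral_uniform_partition[OF f h(1), of n] h(2) by (simp add: sum_subtractf)
    also have "\<dots> \<le> (\<Sum>i<n. e' * h)"
      by (intro order_trans[OF sum_abs] sum_mono cell) auto
    also have "\<dots> = e' * t" using h by (simp add: ac_simps)
    also have "\<dots> < e" using e t by (simp add: e'_def field_simps)
    finally show "norm ((\<Sum>i<n. f (real i * (t / real n)) * (t / real n)) - integral {0..t} f) < e"
      by (simp add: h_def)
  qed
qed

lemma grid_mem:
  assumes "0 \<le> t" "i \<le> n"
  shows "real i * (t / real n) \<in> {0..t}"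
proof (cases "n = 0")
  case False
  have "real i * t \<le> real n * t" using assms by (intro mult_right_mono) auto
  then show ?thesis using False assms by (auto simp: field_simps)
qed (use assms in auto)

text \<open>A pathwise limit of Riemann sums, hence measurable as soon as each \<open>X u\<close>
  is, without joint measurability in time and \<omega>.\<close>

lemma borel_measurable_integral_path:
  fixes X :: "real \<Rightarrow> 'a \<Rightarrow> real"
  assumes X: "\<And>u. u \<in> {0..t} \<Longrightarrow> X u \<in> borel_measurable M"
    and cont: "\<And>\<omega>. \<omega> \<in> space M \<Longrightarrow> continuous_on {0..t} (\<lambda>u. X u \<omega>)" and t: "0 \<le> t"
  shows "(\<lambda>\<omega>. integral {0..t} (\<lambda>u. X u \<omega>)) \<in> borel_measurable M"
proof (rule borel_measurable_LIMSEQ_real)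
  fix \<omega> assume "\<omega> \<in> space M"
  then show "(\<lambda>n. \<Sum>i<n. X (real i * (t / real n)) \<omega> * (t / real n)) \<longlonglongrightarrow> integral {0..t} (\<lambda>u. X u \<omega>)"
    using cont t by (intro riemann_sum_tendsto) auto
next
  fix n
  show "(\<lambda>\<omega>. \<Sum>i<n. X (real i * (t / real n)) \<omega> * (t / real n)) \<in> borel_measurable M"
    using grid_mem[OF t] X by (intro borel_measurable_sum borel_measurable_times) auto
qed

text \<open>Fatou's lemma in the form used for every passage to a limit of moments: from Riemann
  sums to time integrals, from discrete to stochastic integrals, from fine grids to the exact
  integral, from localised to full moments.\<close>

lemma nn_moment_fatou:
  fixes X :: "nat \<Rightarrow> 'a \<Rightarrow> real"
  assumes [measurable]: "\<And>n. X n \<in> borel_measurable M"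
    and lim: "AE \<omega> in M. (\<lambda>n. X n \<omega>) \<longlonglongrightarrow> Z \<omega>"
    and le: "\<And>n. (\<integral>\<^sup>+ \<omega>. ennreal (X n \<omega> ^ p) \<partial>M) \<le> K"
  shows "(\<integral>\<^sup>+ \<omega>. ennreal (Z \<omega> ^ p) \<partial>M) \<le> K"
proof -
  have "(\<integral>\<^sup>+ \<omega>. ennreal (Z \<omega> ^ p) \<partial>M) = (\<integral>\<^sup>+ \<omega>. liminf (\<lambda>n. ennreal (X n \<omega> ^ p)) \<partial>M)"
  proof (rule nn_integral_cong_AE, use lim in eventually_elim)
    case (elim \<omega>)
    then have "(\<lambda>n. ennreal (X n \<omega> ^ p)) \<longlonglongrightarrow> ennreal (Z \<omega> ^ p)"
      by (intro tendsto_ennrealI tendsto_intros)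
    then show ?case by (simp add: lim_imp_Liminf)
  qed
  also have "\<dots> \<le> liminf (\<lambda>n. \<integral>\<^sup>+ \<omega>. ennreal (X n \<omega> ^ p) \<partial>M)"
    by (intro nn_integral_liminf) auto
  also have "\<dots> \<le> limsup (\<lambda>n. \<integral>\<^sup>+ \<omega>. ennreal (X n \<omega> ^ p) \<partial>M)"
    by (intro Liminf_le_Limsup) auto
  also have "\<dots> \<le> K"
    using le by (intro Limsup_bounded always_eventually) auto
  finally show ?thesis .
qed

lemma power_mean_even:
  fixes z :: "nat \<Rightarrow> real"
  assumes "n > 0"
  shows "((\<Sum>i<n. z i) / real n) ^ (2 * m) \<le> (\<Sum>i<n. z i ^ (2 * m)) / real n"
proof -
  have "(\<Sum>i<n. (1 / real n) *\<^sub>R z i) ^ (2 * m) \<le> (\<Sum>i<n. (1 / real n) * z i ^ (2 * m))"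
    using assms convex_on_sum[of "{..<n}" UNIV "\<lambda>x. x ^ (2 * m)" "\<lambda>i. 1 / real n" z]
    by (auto simp: convex_power_even)
  then show ?thesis by (simp add: sum_divide_distrib)
qed

text \<open>Jensen for two equal weights gives half of this constant; the factor 1/2 is
  dropped.\<close>

lemma power_add_le_even:
  fixes x y :: real
  shows "(x + y) ^ (2 * m) \<le> 4 ^ m * (x ^ (2 * m) + y ^ (2 * m))"
proof -
  have "((\<Sum>i<2::nat. (if i = 0 then x else y)) / real 2) ^ (2 * m)
      \<le> (\<Sum>i<2::nat. (if i = 0 then x else y) ^ (2 * m)) / real 2"
    by (rule power_mean_even) simp
  then have "((x + y) / 2) ^ (2 * m) \<le> (x ^ (2 * m) + y ^ (2 * m)) / 2"
    by (simp add: numeral_2_eq_2)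
  then have "(x + y) ^ (2 * m) / 4 ^ m \<le> (x ^ (2 * m) + y ^ (2 * m)) / 2"
    by (simp add: power_divide power_mult)
  also have "\<dots> \<le> x ^ (2 * m) + y ^ (2 * m)" by simp
  finally show ?thesis by (simp add: field_simps)
qed

lemma nn_moment_average:
  fixes Z :: "nat \<Rightarrow> 'a \<Rightarrow> real"
  assumes [measurable]: "\<And>i. i < n \<Longrightarrow> Z i \<in> borel_measurable M"
    and le: "\<And>i. i < n \<Longrightarrow> (\<integral>\<^sup>+ \<omega>. ennreal (Z i \<omega> ^ (2 * m)) \<partial>M) \<le> ennreal K"
    and m: "m > 0" and K: "K \<ge> 0"
  shows "(\<integral>\<^sup>+ \<omega>. ennreal ((\<Sum>i<n. Z i \<omega> * (t / real n)) ^ (2 * m)) \<partial>M) \<le> ennreal (t ^ (2 * m) * K)"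
proof (cases "n = 0")
  case True
  then show ?thesis using m by (simp add: zero_power)
next
  case False
  have pt: "ennreal ((\<Sum>i<n. Z i \<omega> * (t / real n)) ^ (2 * m))
      \<le> ennreal (t ^ (2 * m) / real n) * (\<Sum>i<n. ennreal (Z i \<omega> ^ (2 * m)))" for \<omega>
  proof -
    have "(\<Sum>i<n. Z i \<omega> * (t / real n)) = t * ((\<Sum>i<n. Z i \<omega>) / real n)"
      by (simp add: sum_distrib_left sum_divide_distrib mult.commute)
    then have "(\<Sum>i<n. Z i \<omega> * (t / real n)) ^ (2 * m) = t ^ (2 * m) * ((\<Sum>i<n. Z i \<omega>) / real n) ^ (2 * m)"
      by (simp only: power_mult_distrib)
    also have "\<dots> \<le> t ^ (2 * m) * ((\<Sum>i<n. Z i \<omega> ^ (2 * m)) / real n)"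
      using power_mean_even[of n "\<lambda>i. Z i \<omega>" m] False by (intro mult_left_mono) auto
    finally have "ennreal ((\<Sum>i<n. Z i \<omega> * (t / real n)) ^ (2 * m))
        \<le> ennreal (t ^ (2 * m) / real n * (\<Sum>i<n. Z i \<omega> ^ (2 * m)))"
      by (intro ennreal_leI) simp
    also have "\<dots> = ennreal (t ^ (2 * m) / real n) * (\<Sum>i<n. ennreal (Z i \<omega> ^ (2 * m)))"
      by (subst ennreal_mult) (auto simp: sum_nonneg)
    finally show ?thesis .
  qed
  have "(\<integral>\<^sup>+ \<omega>. ennreal ((\<Sum>i<n. Z i \<omega> * (t / real n)) ^ (2 * m)) \<partial>M)
      \<le> (\<integral>\<^sup>+ \<omega>. ennreal (t ^ (2 * m) / real n) * (\<Sum>i<n. ennreal (Z i \<omega> ^ (2 * m))) \<partial>M)"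
    by (intro nn_integral_mono pt)
  also have "\<dots> = ennreal (t ^ (2 * m) / real n) * (\<Sum>i<n. \<integral>\<^sup>+ \<omega>. ennreal (Z i \<omega> ^ (2 * m)) \<partial>M)"
    proof -
    have "(\<integral>\<^sup>+ \<omega>. (\<Sum>i<n. ennreal (Z i \<omega> ^ (2 * m))) \<partial>M) = (\<Sum>i<n. \<integral>\<^sup>+ \<omega>. ennreal (Z i \<omega> ^ (2 * m)) \<partial>M)"
      by (rule nn_integral_sum) auto
    then show ?thesis by (subst nn_integral_cmult) auto
  qed
  also have "\<dots> \<le> ennreal (t ^ (2 * m) / real n) * (\<Sum>i<n. ennreal K)"
    by (rule mult_left_mono[OF sum_mono]) (use le in auto)
  also have "\<dots> = ennreal (t ^ (2 * m) * K)"
  proof -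
    have "t ^ (2 * m) * K = t ^ (2 * m) / real n * (real n * K)" using False by simp
    then have "ennreal (t ^ (2 * m) * K) = ennreal (t ^ (2 * m) / real n) * (ennreal (real n) * ennreal K)"
      using K by (metis ennreal_mult ennreal_mult'' divide_nonneg_nonneg mult_nonneg_nonneg of_nat_0_le_iff zero_le_even_power' )
    then show ?thesis by (simp only: ennreal_of_nat_eq_real_of_nat sum_constant card_lessThan)
  qed
  finally show ?thesis .
qed

text \<open>Limit of the averages over uniform grids; this takes the place of Minkowski's integral
  inequality and needs no exchange of integrals.\<close>

lemma nn_moment_time_integral:
  fixes g :: "real \<Rightarrow> 'a \<Rightarrow> real"
  assumes meas: "\<And>u. u \<in> {0..t} \<Longrightarrow> g u \<in> borel_measurable M"
    and cont: "\<And>\<omega>. \<omega> \<in> space M \<Longrightarrow> continuous_on {0..t} (\<lambda>u. g u \<omega>)"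
    and le: "\<And>u. u \<in> {0..t} \<Longrightarrow> (\<integral>\<^sup>+ \<omega>. ennreal (g u \<omega> ^ (2 * m)) \<partial>M) \<le> ennreal K"
    and t: "0 \<le> t" and m: "m > 0" and K: "K \<ge> 0"
  shows "(\<integral>\<^sup>+ \<omega>. ennreal (integral {0..t} (\<lambda>u. g u \<omega>) ^ (2 * m)) \<partial>M) \<le> ennreal (t ^ (2 * m) * K)"
proof (rule nn_moment_fatou)
  show "(\<lambda>\<omega>. \<Sum>i<n. g (real i * (t / real n)) \<omega> * (t / real n)) \<in> borel_measurable M" for n
    using grid_mem[OF t] meas by (intro borel_measurable_sum borel_measurable_times) auto
  show "AE \<omega> in M. (\<lambda>n. \<Sum>i<n. g (real i * (t / real n)) \<omega> * (t / real n)) \<longlonglongrightarrow> integral {0..t} (\<lambda>u. g u \<omega>)"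
    using cont t by (intro AE_I2 riemann_sum_tendsto) auto
  show "(\<integral>\<^sup>+ \<omega>. ennreal ((\<Sum>i<n. g (real i * (t / real n)) \<omega> * (t / real n)) ^ (2 * m)) \<partial>M)
      \<le> ennreal (t ^ (2 * m) * K)" for n
    using grid_mem[OF t] meas le m K by (intro nn_moment_average) auto
qed

section \<open>Convergence in probability\<close>

definition conv_in_prob :: "'a measure \<Rightarrow> (nat \<Rightarrow> 'a \<Rightarrow> real) \<Rightarrow> ('a \<Rightarrow> real) \<Rightarrow> bool" where
  "conv_in_prob M X Z \<longleftrightarrow> (\<forall>e>0. (\<lambda>n. measure M {\<omega>\<in>space M. \<bar>X n \<omega> - Z \<omega>\<bar> > e}) \<longlonglongrightarrow> 0)"

lemma conv_in_prob_subseq: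
  "conv_in_prob M X Z \<Longrightarrow> filterlim s at_top sequentially \<Longrightarrow> conv_in_prob M (\<lambda>n. X (s n)) Z"
  unfolding conv_in_prob_def
  by (intro allI impI filterlim_compose[where f = s and g = "\<lambda>n. measure M {\<omega>\<in>space M. \<bar>X n \<omega> - Z \<omega>\<bar> > _}"]) simp_all

context finite_measure
begin

lemma conv_in_prob_add:
  assumes [measurable]: "\<And>n. X n \<in> borel_measurable M" "Z \<in> borel_measurable M"
      "\<And>n. Y n \<in> borel_measurable M" "U \<in> borel_measurable M"
    and X: "conv_in_prob M X Z" and Y: "conv_in_prob M Y U"
  shows "conv_in_prob M (\<lambda>n \<omega>. X n \<omega> + Y n \<omega>) (\<lambda>\<omega>. Z \<omega> + U \<omega>)"
  unfolding conv_in_prob_def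
proof (intro allI impI)
  fix e :: real assume e: "e > 0"
  let ?A = "\<lambda>n. {\<omega>\<in>space M. \<bar>X n \<omega> - Z \<omega>\<bar> > e / 2}"
  let ?B = "\<lambda>n. {\<omega>\<in>space M. \<bar>Y n \<omega> - U \<omega>\<bar> > e / 2}"
  have lim: "(\<lambda>n. measure M (?A n) + measure M (?B n)) \<longlonglongrightarrow> 0 + 0"
    using X[unfolded conv_in_prob_def, rule_format, of "e / 2"] Y[unfolded conv_in_prob_def, rule_format, of "e / 2"] e
    by (intro tendsto_add) (simp_all del: less_divide_eq_numeral1)
  show "(\<lambda>n. measure M {\<omega>\<in>space M. \<bar>X n \<omega> + Y n \<omega> - (Z \<omega> + U \<omega>)\<bar> > e}) \<longlonglongrightarrow> 0"
  proof (rule real_tendsto_sandwich[OF _ _ tendsto_const[of 0]])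
    have "measure M {\<omega>\<in>space M. \<bar>X n \<omega> + Y n \<omega> - (Z \<omega> + U \<omega>)\<bar> > e} \<le> measure M (?A n \<union> ?B n)" for n
    proof (rule finite_measure_mono)
      have "x \<in> ?A n" if "x \<in> space M" "x \<notin> ?B n" "\<bar>X n x + Y n x - (Z x + U x)\<bar> > e" for x
        proof -
        have "\<bar>X n x - Z x\<bar> > e / 2"
          using that abs_diff_triangle_ineq[of "X n x" "Y n x" "Z x" "U x"] by (simp del: less_divide_eq_numeral1)
        then show ?thesis using that by blast
      qed
      then show "{\<omega>\<in>space M. \<bar>X n \<omega> + Y n \<omega> - (Z \<omega> + U \<omega>)\<bar> > e} \<subseteq> ?A n \<union> ?B n"
        by blast
    qed measurable
    also have "measure M (?A n \<union> ?B n) \<le> measure M (?A n) + measure M (?B n)" for n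
      by (rule measure_Un_le) auto
    finally show "eventually (\<lambda>n. measure M {\<omega>\<in>space M. \<bar>X n \<omega> + Y n \<omega> - (Z \<omega> + U \<omega>)\<bar> > e}
        \<le> measure M (?A n) + measure M (?B n)) sequentially" by simp
    show "(\<lambda>n. measure M (?A n) + measure M (?B n)) \<longlonglongrightarrow> 0" using lim by simp
  qed simp
qed

lemma conv_in_prob_const: "conv_in_prob M (\<lambda>n. Z) Z"
  by (simp add: conv_in_prob_def)

lemma conv_in_prob_cmult:
  assumes X: "conv_in_prob M X Z"
  shows "conv_in_prob M (\<lambda>n \<omega>. c * X n \<omega>) (\<lambda>\<omega>. c * Z \<omega>)"
proof (cases "c = 0")
  case True
  then show ?thesis by (simp add: conv_in_prob_const)
next
  case False
  have "(\<bar>c * x - c * z\<bar> > e) = (\<bar>x - z\<bar> > e / \<bar>c\<bar>)" for e x z :: real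
    using False by (simp add: right_diff_distrib[symmetric] abs_mult pos_divide_less_eq mult.commute)
  then show ?thesis using X False by (simp only: conv_in_prob_def) simp
qed

lemma conv_in_prob_sum:
  assumes "finite I" "\<And>n i. i \<in> I \<Longrightarrow> X i n \<in> borel_measurable M"
    "\<And>i. i \<in> I \<Longrightarrow> Z i \<in> borel_measurable M" "\<And>i. i \<in> I \<Longrightarrow> conv_in_prob M (X i) (Z i)"
  shows "conv_in_prob M (\<lambda>n \<omega>. \<Sum>i\<in>I. X i n \<omega>) (\<lambda>\<omega>. \<Sum>i\<in>I. Z i \<omega>)"
  using assms
proof (induction I rule: finite_induct)
  case empty
  show ?case by (simp add: conv_in_prob_const)
next
  case (insert a I)
  then show ?case by (auto intro!: conv_in_prob_add borel_measurable_sum)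
qed

text \<open>Indices whose exceptional probability is below 2^-n make the exceptional events
  summable, and Borel-Cantelli applies. The chosen indices need not increase; only the almost sure
  limit along them is used.\<close>

lemma conv_in_prob_AE_subseq:
  assumes [measurable]: "\<And>n. X n \<in> borel_measurable M" "Z \<in> borel_measurable M"
    and X: "conv_in_prob M X Z"
  obtains s :: "nat \<Rightarrow> nat" where "AE \<omega> in M. (\<lambda>n. X (s n) \<omega>) \<longlonglongrightarrow> Z \<omega>"
proof -
  have "\<exists>i. measure M {\<omega>\<in>space M. \<bar>X i \<omega> - Z \<omega>\<bar> > (1/2) ^ n} < (1/2) ^ n" for n :: nat
  proof -
    have "(\<lambda>i. measure M {\<omega>\<in>space M. \<bar>X i \<omega> - Z \<omega>\<bar> > (1/2) ^ n}) \<longlonglongrightarrow> 0"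
      using X by (simp add: conv_in_prob_def)
    then have "eventually (\<lambda>i. measure M {\<omega>\<in>space M. \<bar>X i \<omega> - Z \<omega>\<bar> > (1/2) ^ n} < (1/2) ^ n) sequentially"
      by (rule order_tendstoD) simp
    then show ?thesis by (meson eventually_happens' sequentially_bot)
  qed
  then obtain s where s: "\<And>n :: nat. measure M {\<omega>\<in>space M. \<bar>X (s n) \<omega> - Z \<omega>\<bar> > (1/2) ^ n} < (1/2) ^ n"
    by metis
  have "AE \<omega> in M. eventually (\<lambda>n. \<omega> \<in> space M - {\<omega>\<in>space M. \<bar>X (s n) \<omega> - Z \<omega>\<bar> > (1/2) ^ n}) sequentially"
  proof (rule borel_cantelli_AE1)
    show "summable (\<lambda>n. measure M {\<omega>\<in>space M. \<bar>X (s n) \<omega> - Z \<omega>\<bar> > (1/2) ^ n})"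
      using s by (intro summable_comparison_test'[OF summable_geometric[of "1/2 :: real"], of 0])
        (auto simp: less_imp_le)
  qed (auto simp: emeasure_eq_measure)
  then have "AE \<omega> in M. (\<lambda>n. X (s n) \<omega>) \<longlonglongrightarrow> Z \<omega>"
  proof eventually_elim
    case (elim \<omega>)
    have "(\<lambda>n. X (s n) \<omega> - Z \<omega>) \<longlonglongrightarrow> 0"
    proof (rule Lim_null_comparison)
      show "eventually (\<lambda>n. norm (X (s n) \<omega> - Z \<omega>) \<le> (1/2) ^ n) sequentially"
        using elim by eventually_elim auto
      show "(\<lambda>n. (1/2 :: real) ^ n) \<longlonglongrightarrow> 0" by (simp add: LIMSEQ_power_zero)
    qed
    then show ?case by (simp add: LIM_zero_iff)
  qed
  then show ?thesis using that by blast
qed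

end

subsection \<open>Moments of discrete martingale transforms\<close>

text \<open>The larger of a and b dominates the product; a weight-free form of Young's
  inequality.\<close>

lemma power_mult_le_add:
  fixes a b :: real
  assumes "0 \<le> a" "0 \<le> b"
  shows "a ^ i * b ^ j \<le> a ^ (i + j) + b ^ (i + j)"
proof (cases "a \<le> b")
  case True
  then have "a ^ i * b ^ j \<le> b ^ i * b ^ j"
    using assms by (intro mult_right_mono power_mono) auto
  then show ?thesis using assms by (simp add: power_add add.commute add_increasing)
next
  case False
  then have "a ^ i * b ^ j \<le> a ^ i * a ^ j"
    using assms by (intro mult_left_mono power_mono) auto
  then show ?thesis using assms by (simp add: power_add add_increasing2)
qed

text \<open>Constant and linear term are kept exactly, because the linear one will have expectation
  zero when y has mean zero given x. All higher terms contain y^2 and are estimated crudely.\<close>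

lemma power_even_taylor_le:
  fixes x y :: real
  assumes m: "m > 0"
  shows "(x + y) ^ (2 * m) \<le> x ^ (2 * m) + real (2 * m) * x ^ (2 * m - 1) * y
    + 4 ^ m * (x ^ (2 * m - 2) * y\<^sup>2 + y ^ (2 * m))"
proof -
  define n where "n = 2 * m - 2"
  have n: "2 * m = Suc (Suc n)" using m by (simp add: n_def)
  define R where "R = x ^ n * y\<^sup>2 + y ^ (2 * m)"
  have ev: "even n" using m by (simp add: n_def)
  have R_nonneg: "R \<ge> 0" using ev unfolding R_def by (intro add_nonneg_nonneg mult_nonneg_nonneg) (auto simp: zero_le_even_power)
  \<comment> \<open>With y^2 split off, the remaining monomial has degree
    \<open>n = 2 * m - 2\<close> and is at most |x|^n + |y|^n.\<close>
  have tail: "real (Suc (Suc n) choose Suc (Suc k)) * y ^ Suc (Suc k) * x ^ (Suc (Suc n) - Suc (Suc k))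
      \<le> real (Suc (Suc n) choose Suc (Suc k)) * R" if k: "k \<le> n" for k
  proof -
    have "y ^ Suc (Suc k) * x ^ (n - k) \<le> \<bar>y ^ Suc (Suc k) * x ^ (n - k)\<bar>" by simp
    also have "\<dots> = (\<bar>x\<bar> ^ (n - k) * \<bar>y\<bar> ^ k) * y\<^sup>2"
      by (simp add: abs_mult power_abs power2_eq_square ac_simps)
    also have "\<dots> \<le> (\<bar>x\<bar> ^ n + \<bar>y\<bar> ^ n) * y\<^sup>2"
      using power_mult_le_add[of "\<bar>x\<bar>" "\<bar>y\<bar>" "n - k" k] k by (intro mult_right_mono) auto
    also have "\<dots> = R"
      using ev unfolding n R_def by (simp add: power2_eq_square distrib_right power_even_abs)
    finally show ?thesis
      by (simp add: mult.assoc mult_left_mono del: binomial_Suc_Suc)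
  qed
  have "(x + y) ^ (2 * m) = (\<Sum>k\<le>Suc (Suc n). real (Suc (Suc n) choose k) * y ^ k * x ^ (Suc (Suc n) - k))"
    unfolding n by (subst add.commute, rule binomial_ring)
  also have "\<dots> = x ^ Suc (Suc n) + real (Suc (Suc n)) * y * x ^ Suc n
      + (\<Sum>k\<le>n. real (Suc (Suc n) choose Suc (Suc k)) * y ^ Suc (Suc k) * x ^ (Suc (Suc n) - Suc (Suc k)))"
    by (simp add: sum.atMost_Suc_shift del: sum.atMost_Suc binomial_Suc_Suc)
  also have "(\<Sum>k\<le>n. real (Suc (Suc n) choose Suc (Suc k)) * y ^ Suc (Suc k) * x ^ (Suc (Suc n) - Suc (Suc k)))
      \<le> (\<Sum>k\<le>n. real (Suc (Suc n) choose Suc (Suc k)) * R)"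
    by (intro sum_mono tail) auto
  \<comment> \<open>Restoring the two missing binomial coefficients completes a row, whose sum
    2^(2m) is the constant \<open>4 ^ m\<close>.\<close>
  also have "\<dots> \<le> (\<Sum>k\<le>Suc (Suc n). real (Suc (Suc n) choose k) * R)"
    using R_nonneg by (simp only: sum.atMost_Suc_shift[where n = "Suc n"] sum.atMost_Suc_shift[where n = n])
      (simp del: sum.atMost_Suc binomial_Suc_Suc)
  also have "\<dots> = 4 ^ m * R"
  proof -
    have "(\<Sum>k\<le>Suc (Suc n). real (Suc (Suc n) choose k)) = real (2 ^ (2 * m))"
      unfolding n choose_row_sum[symmetric] by (simp only: of_nat_sum)
    then show ?thesis by (simp only: sum_distrib_right[symmetric]) (simp add: power_mult)
  qed
  finally have "(x + y) ^ (2 * m) \<le> x ^ Suc (Suc n) + real (Suc (Suc n)) * y * x ^ Suc n + 4 ^ m * R"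
    by simp
  then show ?thesis unfolding R_def n by (simp add: ac_simps)
qed

lemma integrable_power_mult_power:
  fixes f g :: "'a \<Rightarrow> real"
  assumes f: "integrable M (\<lambda>x. f x ^ (2 * m))" and g: "integrable M (\<lambda>x. g x ^ (2 * m))"
    and [measurable]: "f \<in> borel_measurable M" "g \<in> borel_measurable M"
    and ij: "i + j = 2 * m"
  shows "integrable M (\<lambda>x. f x ^ i * g x ^ j)"
proof (rule Bochner_Integration.integrable_bound[OF Bochner_Integration.integrable_add[OF f g]])
  show "AE x in M. norm (f x ^ i * g x ^ j) \<le> norm (f x ^ (2 * m) + g x ^ (2 * m))"
  proof (rule AE_I2)
    fix x
    have "\<bar>f x ^ i * g x ^ j\<bar> \<le> \<bar>f x\<bar> ^ (2 * m) + \<bar>g x\<bar> ^ (2 * m)"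
      using power_mult_le_add[of "\<bar>f x\<bar>" "\<bar>g x\<bar>" i j] ij by (simp add: abs_mult power_abs)
    then show "norm (f x ^ i * g x ^ j) \<le> norm (f x ^ (2 * m) + g x ^ (2 * m))"
      by (simp add: power_even_abs)
  qed
qed measurable

text \<open>The factor \<open>fact (2 * m) / (2 ^ m * fact m)\<close> is the moment of order 2m of a
  standard normal variable, \<open>4 ^ m\<close> comes from \<open>power_even_taylor_le\<close>, and
  the exponential bounds (1 + C / P)^P uniformly in the number P of steps.\<close>

definition mart_const :: "nat \<Rightarrow> real" where
  "mart_const m = exp (4 ^ m * (1 + fact (2 * m) / (2 ^ m * fact m)))"

lemma mart_const_pos: "mart_const m > 0"
  by (simp add: mart_const_def)

context prob_space
begin

text \<open>U depends on the past and D is the Gaussian increment after it; by independence the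
  expectation of the product factorises, and the first moment of D vanishes.\<close>

lemma indep_normal_moments:
  assumes D: "distributed M lborel D (normal_density 0 (sqrt \<delta>))" and \<delta>: "\<delta> > 0"
    and sub: "subalgebra M G" and ind: "indep_set (sets G) (gen_sigma M {D})"
    and U: "U \<in> borel_measurable G" "integrable M U"
  shows "integrable M (\<lambda>\<omega>. U \<omega> * D \<omega> ^ k)"
    and "expectation (\<lambda>\<omega>. U \<omega> * D \<omega>) = 0"
    and "expectation (\<lambda>\<omega>. U \<omega> * D \<omega> ^ (2 * k))
      = expectation U * (\<delta> ^ k * (fact (2 * k) / (2 ^ k * fact k)))"
proof -
  have s: "sqrt \<delta> > 0" using \<delta> by simp
  have Dm: "D \<in> borel_measurable M"
    using distributed_measurable[OF D] by simp
  have UM: "U \<in> borel_measurable M"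
    using U(1) sub by (rule measurable_from_subalg[rotated])
  have dens: "0 \<le> normal_density 0 (sqrt \<delta>) x" for x by simp
  have Di: "integrable M (\<lambda>\<omega>. D \<omega> ^ k)" for k
    using distributed_integrable[OF D, of "\<lambda>x. x ^ k"] integrable_normal_moment[OF s, of 0 k] by simp
  \<comment> \<open>U is measurable for G, and every power of D generates a sub-sigma-algebra of
    that of D, so the pair inherits the independence of the two larger families.\<close>
  have iv: "indep_var borel U borel (\<lambda>\<omega>. D \<omega> ^ k)" for k
  proof -
    have G_sub: "sigma_sets (space M) {U -` A \<inter> space M |A. A \<in> sets borel} \<subseteq> sets G"
    proof -
      have sp: "space M = space G" using sub by (simp add: subalgebra_def)
      show ?thesis
        unfolding sp using measurable_sets[OF U(1)] by (intro sets.sigma_sets_subset) auto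
    qed
    have D_sub: "sigma_sets (space M) {(\<lambda>\<omega>. D \<omega> ^ k) -` A \<inter> space M |A. A \<in> sets borel} \<subseteq> gen_sigma M {D}"
      unfolding gen_sigma_def
    proof (rule sigma_sets_mono')
      show "{(\<lambda>\<omega>. D \<omega> ^ k) -` A \<inter> space M |A. A \<in> sets borel}
          \<subseteq> {X -` B \<inter> space M |X B. X \<in> {D} \<and> B \<in> sets borel}"
      proof safe
        fix A :: "real set" assume "A \<in> sets borel"
        then have "(\<lambda>x::real. x ^ k) -` A \<in> sets borel"
          using measurable_sets[of "\<lambda>x::real. x ^ k" borel borel A] by auto
        moreover have "(\<lambda>\<omega>. D \<omega> ^ k) -` A \<inter> space M = D -` ((\<lambda>x. x ^ k) -` A) \<inter> space M"
          by auto
        ultimately show "\<exists>X B. (\<lambda>\<omega>. D \<omega> ^ k) -` A \<inter> space M = X -` B \<inter> space M \<and> X \<in> {D} \<and> B \<in> sets borel"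
          by (intro exI[of _ D] exI[of _ "(\<lambda>x. x ^ k) -` A"]) simp
      qed
    qed
    show ?thesis
      unfolding indep_var_eq
    proof (intro conjI)
      show "indep_set (sigma_sets (space M) {U -` A \<inter> space M |A. A \<in> sets borel})
          (sigma_sets (space M) {(\<lambda>\<omega>. D \<omega> ^ k) -` A \<inter> space M |A. A \<in> sets borel})"
        using ind G_sub D_sub unfolding indep_set_def
        by (elim indep_sets_mono_sets) (auto split: bool.split)
    qed (use UM Dm in auto)
  qed
  show "integrable M (\<lambda>\<omega>. U \<omega> * D \<omega> ^ k)"
    by (rule indep_var_integrable[OF iv U(2) Di])
  have "expectation (\<lambda>\<omega>. D \<omega> ^ 1) = 0"
    using distributed_integral[OF D, of "\<lambda>x. x ^ 1"] integral_normal_moment_odd[OF s, of 0 0] by simp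
  then show "expectation (\<lambda>\<omega>. U \<omega> * D \<omega>) = 0"
    using indep_var_lebesgue_integral[OF iv[of 1] U(2) Di[of 1]] by simp
  have "expectation (\<lambda>\<omega>. D \<omega> ^ (2 * k)) = fact (2 * k) / ((2 / \<delta>) ^ k * fact k)"
    using distributed_integral[OF D, of "\<lambda>x. x ^ (2 * k)"] integral_normal_moment_even[OF s, of 0 k] \<delta> by simp
  also have "\<dots> = \<delta> ^ k * (fact (2 * k) / (2 ^ k * fact k))"
    using \<delta> by (simp add: power_divide)
  finally show "expectation (\<lambda>\<omega>. U \<omega> * D \<omega> ^ (2 * k))
      = expectation U * (\<delta> ^ k * (fact (2 * k) / (2 ^ k * fact k)))"
    using indep_var_lebesgue_integral[OF iv[of "2 * k"] U(2) Di[of "2 * k"]] by simp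
qed

text \<open>Splitting the total time \<open>\<tau>\<close> into \<open>P\<close> steps, one step multiplies \<open>E S\<^sup>2\<^sup>m + \<tau>\<^sup>m K\<close> by at most
  \<open>1 + C / P\<close>, because the odd term of the expansion vanishes and the quadratic one carries
  the factor \<open>\<tau> / P\<close>.\<close>
lemma martingale_transform_moment:
  fixes G :: "nat \<Rightarrow> 'a measure" and H D :: "nat \<Rightarrow> 'a \<Rightarrow> real"
  assumes P: "P > 0" and \<tau>: "\<tau> > 0" and m: "m > 0" and K: "K \<ge> 0"
    and sub: "\<And>j. j \<le> P \<Longrightarrow> subalgebra M (G j)"
    and mono: "\<And>j. j < P \<Longrightarrow> sets (G j) \<subseteq> sets (G (Suc j))"
    and H: "\<And>j. j < P \<Longrightarrow> H j \<in> borel_measurable (G j)"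
    and D: "\<And>j. j < P \<Longrightarrow> D j \<in> borel_measurable (G (Suc j))"
    and normal: "\<And>j. j < P \<Longrightarrow> distributed M lborel (D j) (normal_density 0 (sqrt (\<tau> / real P)))"
    and ind: "\<And>j. j < P \<Longrightarrow> indep_set (sets (G j)) (gen_sigma M {D j})"
    and Hmom: "\<And>j. j < P \<Longrightarrow> (\<integral>\<^sup>+ \<omega>. ennreal (H j \<omega> ^ (2 * m)) \<partial>M) \<le> ennreal K"
  shows "(\<integral>\<^sup>+ \<omega>. ennreal ((\<Sum>j<P. H j \<omega> * D j \<omega>) ^ (2 * m)) \<partial>M) \<le> ennreal (mart_const m * (\<tau> ^ m * K))"
proof -
  define \<delta> where "\<delta> = \<tau> / real P"
  have \<delta>: "\<delta> > 0" using P \<tau> by (simp add: \<delta>_def)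
  define c :: real where "c = fact (2 * m) / (2 ^ m * fact m)"
  define C where "C = 4 ^ m * (1 + c)"
  have c: "c \<ge> 0" by (simp add: c_def)
  have C: "C \<ge> 0" using c by (simp add: C_def)
  define S where "S = (\<lambda>j \<omega>. \<Sum>i<j. H i \<omega> * D i \<omega>)"
  have S0: "S 0 = (\<lambda>\<omega>. 0)" and SS: "S (Suc j) = (\<lambda>\<omega>. S j \<omega> + H j \<omega> * D j \<omega>)" for j
    by (simp_all add: S_def)
  have up: "f \<in> borel_measurable (G (Suc j))" if "f \<in> borel_measurable (G j)" "j < P" for f j
    using that mono[of j] sub[of j] sub[of "Suc j"] unfolding measurable_def subalgebra_def by auto
  have inM: "f \<in> borel_measurable M" if "f \<in> borel_measurable (G j)" "j \<le> P" for f j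
    using that sub measurable_from_subalg by blast
  have SG: "j \<le> P \<Longrightarrow> S j \<in> borel_measurable (G j)" for j
  proof (induction j)
    case 0
    then show ?case by (simp add: S0)
  next
    case (Suc j)
    then show ?case unfolding SS by (intro borel_measurable_add borel_measurable_times up H D) auto
  qed
  have Hint: "integrable M (\<lambda>\<omega>. H j \<omega> ^ (2 * m))" "expectation (\<lambda>\<omega>. H j \<omega> ^ (2 * m)) \<le> K" if j: "j < P" for j
  proof -
    have [measurable]: "H j \<in> borel_measurable M" using H[OF j] j by (intro inM) auto
    show "integrable M (\<lambda>\<omega>. H j \<omega> ^ (2 * m))"
      using Hmom[OF j] by (intro integrableI_bounded) (auto simp: le_less_trans[OF _ ennreal_less_top])
    then show "expectation (\<lambda>\<omega>. H j \<omega> ^ (2 * m)) \<le> K"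
      using Hmom[OF j] K by (subst (asm) nn_integral_eq_integral) auto
  qed
  \<comment> \<open>Integrability is carried through the induction: the expectation of a
    nonintegrable function is 0 by convention, so the inequality alone would say nothing.\<close>
  have main: "integrable M (\<lambda>\<omega>. S j \<omega> ^ (2 * m)) \<and>
      expectation (\<lambda>\<omega>. S j \<omega> ^ (2 * m)) + \<tau> ^ m * K \<le> (1 + C / real P) ^ j * (\<tau> ^ m * K)" if "j \<le> P" for j
    using that
  proof (induction j)
    case 0
    then show ?case using m by (simp add: S0 zero_power)
  next
    case (Suc j)
    then have j: "j < P" "j \<le> P" by auto
    note IH = Suc.IH[OF j(2)]
    note indep_moments = indep_normal_moments[OF normal[OF j(1), folded \<delta>_def] \<delta> sub[OF j(2)] ind[OF j(1)]]
    have SjG [measurable]: "S j \<in> borel_measurable (G j)" and HjG [measurable]: "H j \<in> borel_measurable (G j)"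
      using SG H j by auto
    have [measurable]: "S j \<in> borel_measurable M" "H j \<in> borel_measurable M" "D j \<in> borel_measurable M"
      using inM[OF SjG] inM[OF HjG] inM[OF D[OF j(1)]] j by auto
    let ?U1 = "\<lambda>\<omega>. S j \<omega> ^ (2 * m - 1) * H j \<omega>"
    let ?U2 = "\<lambda>\<omega>. S j \<omega> ^ (2 * m - 2) * (H j \<omega>)\<^sup>2"
    let ?U3 = "\<lambda>\<omega>. H j \<omega> ^ (2 * m)"
    have i1: "integrable M ?U1"
      using integrable_power_mult_power[of M "S j" m "H j" "2 * m - 1" 1] IH Hint(1)[OF j(1)] m by simp
    have i2: "integrable M ?U2"
      using integrable_power_mult_power[of M "S j" m "H j" "2 * m - 2" 2] IH Hint(1)[OF j(1)] m by simp
    note i3 = Hint(1)[OF j(1)]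
    have g: "?U1 \<in> borel_measurable (G j)" "?U2 \<in> borel_measurable (G j)" "?U3 \<in> borel_measurable (G j)"
      by measurable
    note m1 = indep_moments[OF g(1) i1] and m2 = indep_moments[OF g(2) i2] and m3 = indep_moments[OF g(3) i3]
    let ?B = "\<lambda>\<omega>. S j \<omega> ^ (2 * m) + real (2 * m) * (?U1 \<omega> * D j \<omega>)
        + 4 ^ m * (?U2 \<omega> * (D j \<omega>)\<^sup>2 + ?U3 \<omega> * D j \<omega> ^ (2 * m))"
    have iD1: "integrable M (\<lambda>\<omega>. ?U1 \<omega> * D j \<omega>)" using m1(1)[of 1] by simp
    have iD2: "integrable M (\<lambda>\<omega>. ?U2 \<omega> * (D j \<omega>)\<^sup>2)" using m2(1)[of 2] by simp
    have iD3: "integrable M (\<lambda>\<omega>. ?U3 \<omega> * D j \<omega> ^ (2 * m))" using m3(1)[of "2 * m"] by simp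
    have iB: "integrable M ?B"
      using IH iD1 iD2 iD3 by (intro Bochner_Integration.integrable_add integrable_mult_right) auto
    have le: "S (Suc j) \<omega> ^ (2 * m) \<le> ?B \<omega>" for \<omega>
      using power_even_taylor_le[OF m, of "S j \<omega>" "H j \<omega> * D j \<omega>"]
      by (simp add: SS power_mult_distrib mult.assoc)
    have i': "integrable M (\<lambda>\<omega>. S (Suc j) \<omega> ^ (2 * m))"
    proof (rule Bochner_Integration.integrable_bound[OF iB])
      show "AE \<omega> in M. norm (S (Suc j) \<omega> ^ (2 * m)) \<le> norm (?B \<omega>)"
        using le by (intro AE_I2) (simp add: order_trans[OF _ abs_ge_self])
    qed (simp add: SS)
    \<comment> \<open>H is scaled by \<open>sqrt \<tau>\<close> before the product is split, so that
      its share becomes \<open>\<tau> ^ m * K\<close>, the quantity that the recursion adds to the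
      moment of S.\<close>
    have U2: "expectation ?U2 * \<delta> \<le> (expectation (\<lambda>\<omega>. S j \<omega> ^ (2 * m)) + \<tau> ^ m * expectation ?U3) / real P"
    proof -
      have "expectation ?U2 * \<tau> = expectation (\<lambda>\<omega>. ?U2 \<omega> * \<tau>)" by simp
      also have "\<dots> \<le> expectation (\<lambda>\<omega>. S j \<omega> ^ (2 * m) + \<tau> ^ m * ?U3 \<omega>)"
      proof (rule integral_mono)
        fix \<omega>
        have "\<bar>S j \<omega>\<bar> ^ (2 * m - 2) * (sqrt \<tau> * \<bar>H j \<omega>\<bar>) ^ 2
            \<le> \<bar>S j \<omega>\<bar> ^ (2 * m - 2 + 2) + (sqrt \<tau> * \<bar>H j \<omega>\<bar>) ^ (2 * m - 2 + 2)"
          using \<tau> by (intro power_mult_le_add) auto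
        also have "2 * m - 2 + 2 = 2 * m" using m by simp
        finally have "\<bar>S j \<omega>\<bar> ^ (2 * m - 2) * (sqrt \<tau> * \<bar>H j \<omega>\<bar>) ^ 2
            \<le> \<bar>S j \<omega>\<bar> ^ (2 * m) + (sqrt \<tau> * \<bar>H j \<omega>\<bar>) ^ (2 * m)" .
        moreover have "even (2 * m - 2)" using m by simp
        moreover have "sqrt \<tau> ^ (2 * m) = \<tau> ^ m" using \<tau> by (simp add: power_mult)
        ultimately show "?U2 \<omega> * \<tau> \<le> S j \<omega> ^ (2 * m) + \<tau> ^ m * ?U3 \<omega>"
          using \<tau> by (simp add: power_mult_distrib power_even_abs mult.commute mult.left_commute)
      qed (use i2 i3 IH in auto)
      also have "\<dots> = expectation (\<lambda>\<omega>. S j \<omega> ^ (2 * m)) + \<tau> ^ m * expectation ?U3"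
        using i3 IH by simp
      finally show ?thesis using P by (simp add: \<delta>_def divide_right_mono)
    qed
    \<comment> \<open>Of the m factors 1 / P only one is kept; that is as much as P steps
      require.\<close>
    have \<delta>m: "\<delta> ^ m \<le> \<tau> ^ m / real P"
    proof -
      have "real P \<le> real P ^ m" using P m by (intro self_le_power) auto
      then show ?thesis using P \<tau> by (simp add: \<delta>_def power_divide frac_le)
    qed
    have U3: "0 \<le> expectation ?U3" "\<tau> ^ m * expectation ?U3 \<le> \<tau> ^ m * K"
      using Hint(2)[OF j(1)] \<tau> by (auto intro!: integral_nonneg_AE)
    have "expectation (\<lambda>\<omega>. S (Suc j) \<omega> ^ (2 * m)) \<le> expectation ?B"
      using i' iB le by (intro integral_mono) auto
    also have "\<dots> = expectation (\<lambda>\<omega>. S j \<omega> ^ (2 * m)) + 4 ^ m * (expectation ?U2 * \<delta> + expectation ?U3 * (\<delta> ^ m * c))"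
      using IH iD1 iD2 iD3 m1(2) m2(3)[of 1] m3(3)[of m] by (simp add: c_def)
    also have "\<dots> \<le> expectation (\<lambda>\<omega>. S j \<omega> ^ (2 * m)) + 4 ^ m *
        ((expectation (\<lambda>\<omega>. S j \<omega> ^ (2 * m)) + \<tau> ^ m * K) / real P + (\<tau> ^ m * K) / real P * c)"
    proof -
      have "expectation ?U3 * (\<delta> ^ m * c) \<le> expectation ?U3 * (\<tau> ^ m / real P * c)"
        using \<delta>m c U3 by (intro mult_left_mono mult_right_mono) auto
      also have "\<dots> = \<tau> ^ m * expectation ?U3 / real P * c" by simp
      also have "\<dots> \<le> \<tau> ^ m * K / real P * c"
        using U3(2) c by (intro mult_right_mono divide_right_mono) auto
      finally have a: "expectation ?U3 * (\<delta> ^ m * c) \<le> \<tau> ^ m * K / real P * c" .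
      have "expectation ?U2 * \<delta> \<le> (expectation (\<lambda>\<omega>. S j \<omega> ^ (2 * m)) + \<tau> ^ m * K) / real P"
        using U3(2) by (intro order_trans[OF U2] divide_right_mono add_left_mono) auto
      then show ?thesis using a by (intro add_left_mono mult_left_mono add_mono) auto
    qed
    \<comment> \<open>A nonnegative multiple of the moment of S is added so that both terms share
      the factor \<open>C / real P\<close>.\<close>
    also have "\<dots> \<le> expectation (\<lambda>\<omega>. S j \<omega> ^ (2 * m))
        + C / real P * (expectation (\<lambda>\<omega>. S j \<omega> ^ (2 * m)) + \<tau> ^ m * K)"
    proof -
      have "0 \<le> expectation (\<lambda>\<omega>. S j \<omega> ^ (2 * m))" by (intro integral_nonneg_AE) auto
      then have "0 \<le> 4 ^ m * (c * expectation (\<lambda>\<omega>. S j \<omega> ^ (2 * m)) / real P)" using c by simp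
      then show ?thesis unfolding C_def by (simp add: algebra_simps add_divide_distrib)
    qed
    finally have "expectation (\<lambda>\<omega>. S (Suc j) \<omega> ^ (2 * m)) + \<tau> ^ m * K
        \<le> (1 + C / real P) * (expectation (\<lambda>\<omega>. S j \<omega> ^ (2 * m)) + \<tau> ^ m * K)"
      by (simp add: algebra_simps)
    also have "\<dots> \<le> (1 + C / real P) * ((1 + C / real P) ^ j * (\<tau> ^ m * K))"
      using IH C by (intro mult_left_mono) auto
    finally show ?case using i' by simp
  qed
  have "(1 + C / real P) ^ P \<le> mart_const m"
  proof -
    have "- real P \<le> C" using C by linarith
    moreover have "mart_const m = exp C" by (simp add: mart_const_def C_def c_def)
    ultimately show ?thesis using exp_ge_one_plus_x_over_n_power_n[of P C] P by simp
  qed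
  then have "(1 + C / real P) ^ P * (\<tau> ^ m * K) \<le> mart_const m * (\<tau> ^ m * K)"
    using \<tau> K by (intro mult_right_mono) auto
  moreover have "0 \<le> \<tau> ^ m * K" using \<tau> K by simp
  ultimately have "expectation (\<lambda>\<omega>. S P \<omega> ^ (2 * m)) \<le> mart_const m * (\<tau> ^ m * K)"
    using main[of P] by linarith
  then show ?thesis
    using main[of P] by (subst nn_integral_eq_integral) (auto simp: S_def ennreal_leI)
qed

end

subsection \<open>Moments of Ito integrals\<close>

text \<open>Turns a weighted sum over R coarse cells into one over their \<open>R * k\<close> fine
  cells; \<open>p div k\<close> is the coarse cell of the fine index p, so the weights stay constant
  on coarse cells.\<close>

lemma sum_weighted_blocks:
  fixes f :: "nat \<Rightarrow> real"
  shows "(\<Sum>l<R. w l * ((\<Sum>p<Suc l * k. f p) - (\<Sum>p<l * k. f p))) = (\<Sum>p<R * k. w (p div k) * f p)"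
proof -
  have "w l * ((\<Sum>p<Suc l * k. f p) - (\<Sum>p<l * k. f p)) = (\<Sum>p\<in>{l * k..<l * k + k}. w (p div k) * f p)" for l
  proof -
    have "(\<Sum>p<l * k. f p) + (\<Sum>p\<in>{l * k..<l * k + k}. f p) = (\<Sum>p<Suc l * k. f p)"
      unfolding lessThan_atLeast0 by (subst sum.atLeastLessThan_concat) (auto simp: add.commute)
    then have "w l * ((\<Sum>p<Suc l * k. f p) - (\<Sum>p<l * k. f p)) = (\<Sum>p\<in>{l * k..<l * k + k}. w l * f p)"
      by (simp add: sum_distrib_left[symmetric])
    also have "\<dots> = (\<Sum>p\<in>{l * k..<l * k + k}. w (p div k) * f p)"
    proof (rule sum.cong)
      fix p assume "p \<in> {l * k..<l * k + k}"
      then have "p div k = l" by (intro div_nat_eqI) (auto simp: mult.commute)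
      then show "w l * f p = w (p div k) * f p" by simp
    qed simp
    finally show ?thesis .
  qed
  then show ?thesis by (simp add: sum.nat_group)
qed

context prob_space
begin

text \<open>The uniform grids of \<open>[0, l t / R]\<close> with \<open>l k\<close> cells are all parts of the one grid of \<open>[0, t]\<close>
  with \<open>R k\<close> cells, so Riemann sums for different upper limits can be subtracted.
  The event \<open>A\<close> allows for a localised integrand \<open>H'\<close>.\<close>
lemma ito_weighted_increments_moment:
  assumes filt: "is_filtration M F" and BM: "is_BM M F T W"
    and t: "0 < t" "t \<le> T" and m: "m > 0" and R: "R > 0" and K: "K \<ge> 0"
    and HF: "\<And>u. u \<in> {0..t} \<Longrightarrow> H u \<in> borel_measurable (F u)"
    and HF': "\<And>u. u \<in> {0..t} \<Longrightarrow> H' u \<in> borel_measurable (F u)"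
    and A: "A \<in> sets M" and eq: "\<And>\<omega> u. \<omega> \<in> A \<Longrightarrow> u \<in> {0..t} \<Longrightarrow> H' u \<omega> = H u \<omega>"
    and mom: "\<And>u. u \<in> {0..t} \<Longrightarrow> (\<integral>\<^sup>+ \<omega>. ennreal (H' u \<omega> ^ (2 * m)) \<partial>M) \<le> ennreal K"
    and ito: "\<And>u. u \<in> {0..t} \<Longrightarrow> ito_integral_is M H W 0 u (Y u)"
    and Ym: "\<And>u. u \<in> {0..t} \<Longrightarrow> Y u \<in> borel_measurable M"
    and Y0: "\<And>\<omega>. \<omega> \<in> space M \<Longrightarrow> Y 0 \<omega> = 0"
    and w: "\<And>l. l < R \<Longrightarrow> \<bar>w l\<bar> \<le> B"
  shows "(\<integral>\<^sup>+ \<omega>. ennreal ((indicator A \<omega> *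
      (\<Sum>l<R. w l * (Y (real (Suc l) * (t / real R)) \<omega> - Y (real l * (t / real R)) \<omega>))) ^ (2 * m)) \<partial>M)
    \<le> ennreal (mart_const m * (t ^ m * (B ^ (2 * m) * K)))"
proof -
  \<comment> \<open>Mesh of the common grid; \<open>Suc i\<close> keeps the number of cells
    positive.\<close>
  define d where "d = (\<lambda>i. t / real (R * Suc i))"
  define dW where "dW = (\<lambda>i p \<omega>. W (real (Suc p) * d i) \<omega> - W (real p * d i) \<omega>)"
  define Gs where "Gs = (\<lambda>l i \<omega>. \<Sum>p<l * Suc i. H (real p * d i) \<omega> * dW i p \<omega>)"
  define Z where "Z = (\<lambda>\<omega>. \<Sum>l<R. w l * (Y (real (Suc l) * (t / real R)) \<omega> - Y (real l * (t / real R)) \<omega>))"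
  have sub: "subalgebra M (F u)" for u
    using filt by (simp add: is_filtration_def)
  have WF: "W u \<in> borel_measurable (F u)" if "u \<in> {0..T}" for u
    using BM that by (simp add: is_BM_def adapted_proc_def)
  have mem: "real p * d i \<in> {0..t}" if "p \<le> R * Suc i" for p i
    using grid_mem[of t p "R * Suc i"] t that unfolding d_def by simp
  have memT: "real p * d i \<in> {0..T}" if "p \<le> R * Suc i" for p i
    using mem[OF that] t by simp
  have inM: "f \<in> borel_measurable M" if "f \<in> borel_measurable (F u)" for f :: "'a \<Rightarrow> real" and u
    using measurable_from_subalg[OF sub that] .
  have dWM: "dW i p \<in> borel_measurable M" if "p < R * Suc i" for i p
    unfolding dW_def using that by (intro borel_measurable_diff inM[OF WF] memT) auto
  have GsM: "Gs l i \<in> borel_measurable M" if "l \<le> R" for l i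
  proof -
    have "p < R * Suc i" if "p < l * Suc i" for p
      using that \<open>l \<le> R\<close> by (meson less_le_trans mult_le_mono1)
    then show ?thesis
      unfolding Gs_def by (intro borel_measurable_sum borel_measurable_times dWM inM[OF HF] mem) (auto simp: less_imp_le)
  qed
  have conv: "conv_in_prob M (Gs l) (Y (real l * (t / real R)))" if l: "l \<le> R" for l
  \<comment> \<open>For \<open>l = 0\<close> the number \<open>l * Suc i\<close> of cells does not
    tend to infinity, but both the sums and the limit are zero.\<close>
  proof (cases "l = 0")
    case True
    have "prob {\<omega> \<in> space M. e < \<bar>Y 0 \<omega>\<bar>} = 0" if "e > 0" for e
    proof -
      have "{\<omega> \<in> space M. e < \<bar>Y 0 \<omega>\<bar>} = {}" using Y0 that by force
      then show ?thesis by (simp only: measure_empty)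
    qed
    with True show ?thesis by (simp add: conv_in_prob_def Gs_def)
  next
    case False
    let ?u = "real l * (t / real R)"
    have u: "?u \<in> {0..t}" using grid_mem[of t l R] t l by simp
    have lim: "filterlim (\<lambda>i. l * Suc i) at_top sequentially"
    proof (rule filterlim_at_top_mono[OF filterlim_Suc])
      have "1 * Suc i \<le> l * Suc i" for i using False by (intro mult_le_mono1) simp
      then show "eventually (\<lambda>i. Suc i \<le> l * Suc i) sequentially"
        by (intro always_eventually allI) (simp only: mult_1)
    qed
    have "conv_in_prob M (\<lambda>n \<omega>. \<Sum>j<n. H (0 + real j * (?u - 0) / real n) \<omega> *
        (W (0 + real (Suc j) * (?u - 0) / real n) \<omega> - W (0 + real j * (?u - 0) / real n) \<omega>)) (Y ?u)"
      \<comment> \<open>\<open>conv_in_prob\<close> repeats the limit in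
        \<open>ito_integral_is\<close> literally, so unfolding both suffices.\<close>
      using ito[OF u] unfolding ito_integral_is_def conv_in_prob_def .
    note conv_in_prob_subseq[OF this lim]
    moreover have "0 + real j * (?u - 0) / real (l * Suc i) = real j * d i" for i j
    proof -
      have "a * (c * (t / r)) / (c * e) = a * (t / (r * e))" if "c \<noteq> 0" for a c e r :: real
        using that by simp
      from this[of "real l" "real j" "real R" "real (Suc i)"] False show ?thesis
        by (simp add: d_def del: of_nat_Suc mult_Suc_right)
    qed
    ultimately show ?thesis by (simp only: Gs_def[abs_def] dW_def)
  qed
  have memR: "real l * (t / real R) \<in> {0..t}" if "l \<le> R" for l
    using grid_mem[of t l R] t that by simp
  have ZM: "Z \<in> borel_measurable M"
    unfolding Z_def by (intro borel_measurable_sum borel_measurable_times borel_measurable_diff Ym memR) auto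
  \<comment> \<open>The difference is written as a sum with factor -1 to fit the closure of
    convergence in probability under sums and constant factors.\<close>
  define S where "S = (\<lambda>i \<omega>. \<Sum>l<R. w l * (Gs (Suc l) i \<omega> + (-1) * Gs l i \<omega>))"
  have SM: "S i \<in> borel_measurable M" for i
    unfolding S_def by (intro borel_measurable_sum borel_measurable_times borel_measurable_add GsM) auto
  have "conv_in_prob M S (\<lambda>\<omega>. \<Sum>l<R. w l * (Y (real (Suc l) * (t / real R)) \<omega> + (-1) * Y (real l * (t / real R)) \<omega>))"
    unfolding S_def
    by (intro conv_in_prob_sum conv_in_prob_cmult conv_in_prob_add conv borel_measurable_times
        borel_measurable_add borel_measurable_const GsM Ym memR) auto
  then have "conv_in_prob M S Z" by (simp add: Z_def)
  then obtain s :: "nat \<Rightarrow> nat" where s: "AE \<omega> in M. (\<lambda>n. S (s n) \<omega>) \<longlonglongrightarrow> Z \<omega>"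
    using conv_in_prob_AE_subseq[where X = S, OF SM ZM] by blast
  \<comment> \<open>The same sum for the localised integrand: it equals \<open>S i\<close> on A
    only, but its moments are bounded on the whole space.\<close>
  define X where "X = (\<lambda>i \<omega>. \<Sum>p<R * Suc i. (w (p div Suc i) * H' (real p * d i) \<omega>) * dW i p \<omega>)"
  have XM: "X i \<in> borel_measurable M" for i
    unfolding X_def by (intro borel_measurable_sum borel_measurable_times dWM inM[OF HF'] mem) auto
  have XS: "X i \<omega> = S i \<omega>" if "\<omega> \<in> A" for i \<omega>
  proof -
    have "S i \<omega> = (\<Sum>p<R * Suc i. w (p div Suc i) * (H (real p * d i) \<omega> * dW i p \<omega>))"
      using sum_weighted_blocks[where k = "Suc i" and f = "\<lambda>p. H (real p * d i) \<omega> * dW i p \<omega>" and w = w and R = R]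
      by (simp add: S_def Gs_def)
    also have "\<dots> = X i \<omega>"
      unfolding X_def by (intro sum.cong) (auto simp: eq[OF that mem])
    finally show ?thesis by simp
  qed
  have Xmom: "(\<integral>\<^sup>+ \<omega>. ennreal (X i \<omega> ^ (2 * m)) \<partial>M) \<le> ennreal (mart_const m * (t ^ m * (B ^ (2 * m) * K)))" for i
    unfolding X_def
  proof (rule martingale_transform_moment[where G = "\<lambda>p. F (real p * d i)"])
    show "0 < R * Suc i" using R by simp
    fix p assume p: "p < R * Suc i"
    have step: "real p * d i < real (Suc p) * d i"
    proof -
      have "0 < d i" using t R by (simp add: d_def del: mult_Suc_right)
      then show ?thesis by simp
    qed
    then show sets: "sets (F (real p * d i)) \<subseteq> sets (F (real (Suc p) * d i))"
      using filt by (simp add: is_filtration_def)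
    show "(\<lambda>\<omega>. w (p div Suc i) * H' (real p * d i) \<omega>) \<in> borel_measurable (F (real p * d i))"
      using p by (intro borel_measurable_times HF' mem) auto
    have "W (real p * d i) \<in> borel_measurable (F (real (Suc p) * d i))"
      using WF[OF memT, of p i] sets p sub[of "real p * d i"] sub[of "real (Suc p) * d i"]
      unfolding measurable_def subalgebra_def by auto
    then show "dW i p \<in> borel_measurable (F (real (Suc p) * d i))"
      unfolding dW_def using p by (intro borel_measurable_diff WF memT) auto
    have "0 \<le> real p * d i" "real (Suc p) * d i \<le> T"
      using memT[of p i] memT[of "Suc p" i] p by auto
    then have incr: "distributed M lborel (dW i p) (normal_density 0 (sqrt (real (Suc p) * d i - real p * d i)))"
        "indep_set (sets (F (real p * d i))) (gen_sigma M {dW i p})"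
      using BM step unfolding is_BM_def dW_def by blast+
    have "real (Suc p) * d i - real p * d i = t / real (R * Suc i)"
      by (simp add: distrib_right del: mult_Suc_right of_nat_mult) (simp add: d_def del: mult_Suc_right)
    with incr(1) show "distributed M lborel (dW i p) (normal_density 0 (sqrt (t / real (R * Suc i))))"
      by (simp only:)
    show "indep_set (sets (F (real p * d i))) (gen_sigma M {dW i p})" by (rule incr(2))
    have wl: "\<bar>w (p div Suc i)\<bar> \<le> B"
      using p by (intro w) (simp add: less_mult_imp_div_less del: mult_Suc_right)
    have "(\<integral>\<^sup>+ \<omega>. ennreal ((w (p div Suc i) * H' (real p * d i) \<omega>) ^ (2 * m)) \<partial>M)
        = ennreal (w (p div Suc i) ^ (2 * m)) * (\<integral>\<^sup>+ \<omega>. ennreal (H' (real p * d i) \<omega> ^ (2 * m)) \<partial>M)"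
      using p inM[OF HF'[OF mem, of p i]]
      by (subst nn_integral_cmult[symmetric]) (auto simp: power_mult_distrib ennreal_mult)
    also have "\<dots> \<le> ennreal (B ^ (2 * m)) * ennreal K"
    proof (rule mult_mono)
      have "\<bar>w (p div Suc i)\<bar> ^ (2 * m) \<le> B ^ (2 * m)" using wl by (intro power_mono) auto
      then show "ennreal (w (p div Suc i) ^ (2 * m)) \<le> ennreal (B ^ (2 * m))"
        by (intro ennreal_leI) (simp add: power_even_abs)
    qed (use mom mem p in auto)
    also have "\<dots> = ennreal (B ^ (2 * m) * K)" using K by (simp add: ennreal_mult)
    finally show "(\<integral>\<^sup>+ \<omega>. ennreal ((w (p div Suc i) * H' (real p * d i) \<omega>) ^ (2 * m)) \<partial>M)
        \<le> ennreal (B ^ (2 * m) * K)" .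
  qed (use t m K sub in auto)
  have "(\<integral>\<^sup>+ \<omega>. ennreal ((indicator A \<omega> * Z \<omega>) ^ (2 * m)) \<partial>M) \<le> ennreal (mart_const m * (t ^ m * (B ^ (2 * m) * K)))"
  proof (rule nn_moment_fatou[where X = "\<lambda>n \<omega>. indicator A \<omega> * X (s n) \<omega>"])
    show "(\<lambda>\<omega>. indicator A \<omega> * X (s n) \<omega>) \<in> borel_measurable M" for n
      using A XM by measurable
    \<comment> \<open>On A the sums \<open>X (s n)\<close> and \<open>S (s n)\<close> coincide, off
      A both sides are 0; hence almost sure convergence of S is enough.\<close>
    show "AE \<omega> in M. (\<lambda>n. indicator A \<omega> * X (s n) \<omega>) \<longlonglongrightarrow> indicator A \<omega> * Z \<omega>"
      using s by eventually_elim (auto simp: indicator_def XS)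
    show "(\<integral>\<^sup>+ \<omega>. ennreal ((indicator A \<omega> * X (s n) \<omega>) ^ (2 * m)) \<partial>M)
        \<le> ennreal (mart_const m * (t ^ m * (B ^ (2 * m) * K)))" for n
      using m by (intro order_trans[OF nn_integral_mono Xmom] ennreal_leI)
        (auto simp: indicator_def zero_power)
  qed
  then show ?thesis by (simp only: Z_def)
qed

end

section \<open>Arithmetic of moment bounds and summation by parts\<close>

lemma nn_moment_add:
  fixes f g :: "'a \<Rightarrow> real"
  assumes [measurable]: "f \<in> borel_measurable M" "g \<in> borel_measurable M"
    and f: "(\<integral>\<^sup>+ \<omega>. ennreal (f \<omega> ^ (2 * m)) \<partial>M) \<le> ennreal a" and a: "a \<ge> 0"
    and g: "(\<integral>\<^sup>+ \<omega>. ennreal (g \<omega> ^ (2 * m)) \<partial>M) \<le> ennreal b" and b: "b \<ge> 0"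
  shows "(\<integral>\<^sup>+ \<omega>. ennreal ((f \<omega> + g \<omega>) ^ (2 * m)) \<partial>M) \<le> ennreal (4 ^ m * (a + b))"
proof -
  have "(\<integral>\<^sup>+ \<omega>. ennreal ((f \<omega> + g \<omega>) ^ (2 * m)) \<partial>M)
      \<le> (\<integral>\<^sup>+ \<omega>. ennreal (4 ^ m) * (ennreal (f \<omega> ^ (2 * m)) + ennreal (g \<omega> ^ (2 * m))) \<partial>M)"
  proof (rule nn_integral_mono)
    fix \<omega>
    have "ennreal ((f \<omega> + g \<omega>) ^ (2 * m)) \<le> ennreal (4 ^ m * (f \<omega> ^ (2 * m) + g \<omega> ^ (2 * m)))"
      by (intro ennreal_leI power_add_le_even)
    then show "ennreal ((f \<omega> + g \<omega>) ^ (2 * m))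
        \<le> ennreal (4 ^ m) * (ennreal (f \<omega> ^ (2 * m)) + ennreal (g \<omega> ^ (2 * m)))"
      by (subst (asm) ennreal_mult) auto
  qed
  also have "\<dots> = ennreal (4 ^ m) * ((\<integral>\<^sup>+ \<omega>. ennreal (f \<omega> ^ (2 * m)) \<partial>M) + (\<integral>\<^sup>+ \<omega>. ennreal (g \<omega> ^ (2 * m)) \<partial>M))"
    by (simp add: nn_integral_cmult nn_integral_add)
  also have "\<dots> \<le> ennreal (4 ^ m) * (ennreal a + ennreal b)"
    using f g by (intro mult_left_mono add_mono) auto
  also have "\<dots> = ennreal (4 ^ m * (a + b))"
    using a b by (simp add: ennreal_mult)
  finally show ?thesis .
qed

lemma nn_moment_cmult:
  fixes f :: "'a \<Rightarrow> real"
  assumes [measurable]: "f \<in> borel_measurable M"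
    and f: "(\<integral>\<^sup>+ \<omega>. ennreal (f \<omega> ^ (2 * m)) \<partial>M) \<le> ennreal a" and a: "a \<ge> 0"
  shows "(\<integral>\<^sup>+ \<omega>. ennreal ((c * f \<omega>) ^ (2 * m)) \<partial>M) \<le> ennreal (c ^ (2 * m) * a)"
proof -
  have "(\<integral>\<^sup>+ \<omega>. ennreal ((c * f \<omega>) ^ (2 * m)) \<partial>M) = ennreal (c ^ (2 * m)) * (\<integral>\<^sup>+ \<omega>. ennreal (f \<omega> ^ (2 * m)) \<partial>M)"
    by (simp add: power_mult_distrib ennreal_mult nn_integral_cmult)
  also have "\<dots> \<le> ennreal (c ^ (2 * m)) * ennreal a"
    using f by (intro mult_left_mono) auto
  finally show ?thesis using a by (simp add: ennreal_mult)
qed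

text \<open>Summation by parts: the increment from l to l + 1 enters \<open>y j - y 0\<close> for
  exactly the N - 1 - l indices j with l < j < N.\<close>

lemma sum_minus_first_weighted:
  fixes y :: "nat \<Rightarrow> real"
  shows "(\<Sum>j<N. y j) - real N * y 0 = (\<Sum>l<N. (real N - 1 - real l) * (y (Suc l) - y l))"
proof (induction N)
  case (Suc N)
  have "(\<Sum>l<N. (real (Suc N) - 1 - real l) * (y (Suc l) - y l))
      = (\<Sum>l<N. (real N - 1 - real l) * (y (Suc l) - y l)) + (\<Sum>l<N. y (Suc l) - y l)"
    by (simp add: sum.distrib[symmetric] algebra_simps)
  then show ?case using Suc by (simp add: sum_lessThan_telescope algebra_simps)
qed simp

text \<open>Summation by parts within each of the n coarse cells; \<open>l mod N\<close> is the
  position of the fine index l in its coarse cell, and \<delta> is the fine mesh.\<close>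

lemma sum_fine_minus_coarse:
  fixes x :: "nat \<Rightarrow> real"
  shows "(\<Sum>j<n * N. x j * \<delta>) - (\<Sum>i<n. x (i * N) * (real N * \<delta>))
    = (\<Sum>l<n * N. (\<delta> * (real N - 1 - real (l mod N))) * (x (Suc l) - x l))"
proof -
  have blocks: "(\<Sum>l<n * N. g l) = (\<Sum>i<n. \<Sum>l<N. g (i * N + l))" for g :: "nat \<Rightarrow> real"
  proof -
    have "(\<Sum>l\<in>{i * N..<i * N + N}. g l) = (\<Sum>l<N. g (i * N + l))" for i
      using sum.shift_bounds_nat_ivl[of g 0 "i * N" N] by (simp add: lessThan_atLeast0 add.commute)
    then show ?thesis by (simp add: sum.nat_group[symmetric])
  qed
  have "(\<Sum>l<n * N. (\<delta> * (real N - 1 - real (l mod N))) * (x (Suc l) - x l))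
      = (\<Sum>i<n. \<Sum>l<N. \<delta> * ((real N - 1 - real l) * (x (i * N + Suc l) - x (i * N + l))))"
    unfolding blocks by (intro sum.cong) auto
  also have "\<dots> = (\<Sum>i<n. \<delta> * ((\<Sum>j<N. x (i * N + j)) - real N * x (i * N)))"
  proof (rule sum.cong)
    fix i
    show "(\<Sum>l<N. \<delta> * ((real N - 1 - real l) * (x (i * N + Suc l) - x (i * N + l))))
        = \<delta> * ((\<Sum>j<N. x (i * N + j)) - real N * x (i * N))"
      using sum_minus_first_weighted[of "\<lambda>j. x (i * N + j)" N] by (simp add: sum_distrib_left[symmetric])
  qed simp
  also have "\<dots> = (\<Sum>j<n * N. x j * \<delta>) - (\<Sum>i<n. x (i * N) * (real N * \<delta>))"
    unfolding blocks by (simp add: sum_subtractf sum_distrib_right[symmetric] sum_distrib_left[symmetric] algebra_simps)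
  finally show ?thesis by simp
qed

section \<open>Stochastic differential equations with continuous coefficients\<close>

locale sde = prob_space M for M :: "'a measure" +
  fixes F :: "real \<Rightarrow> 'a measure" and T :: real and b s :: "real \<Rightarrow> real \<Rightarrow> real"
    and W X :: "real \<Rightarrow> 'a \<Rightarrow> real"
  assumes filt: "is_filtration M F" and BM: "is_BM M F T W" and T_pos: "T > 0"
    and sol: "sde_solution M F T b s W X"
    and b_cont: "continuous_on ({0..T} \<times> UNIV) (\<lambda>(t, x). b t x)"
    and s_cont: "continuous_on ({0..T} \<times> UNIV) (\<lambda>(t, x). s t x)"
begin

text \<open>The stochastic integral, taken as what the equation leaves over, so that X splits into
  initial value, drift and noise at every \<omega> and not only almost surely.\<close>

definition noise :: "real \<Rightarrow> 'a \<Rightarrow> real" where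
  "noise t \<omega> = X t \<omega> - X 0 \<omega> - integral {0..t} (\<lambda>u. b u (X u \<omega>))"

lemma subalg: "subalgebra M (F u)"
  using filt by (simp add: is_filtration_def)

lemma measurable_F_M: "f \<in> borel_measurable (F u) \<Longrightarrow> f \<in> borel_measurable M"
  using measurable_from_subalg[OF subalg] .

lemma X_adapted: "u \<in> {0..T} \<Longrightarrow> X u \<in> borel_measurable (F u)"
  using sol by (simp add: sde_solution_def adapted_proc_def)

lemma X_measurable: "u \<in> {0..T} \<Longrightarrow> X u \<in> borel_measurable M"
  by (rule measurable_F_M[OF X_adapted])

lemma X_cont: "\<omega> \<in> space M \<Longrightarrow> continuous_on {0..T} (\<lambda>u. X u \<omega>)"
  using sol by (simp add: sde_solution_def cont_paths_def)

lemma section_measurable: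
  fixes f :: "real \<Rightarrow> real \<Rightarrow> real"
  assumes "continuous_on ({0..T} \<times> UNIV) (\<lambda>(t, x). f t x)" "u \<in> {0..T}"
  shows "f u \<in> borel_measurable borel"
proof (rule borel_measurable_continuous_onI)
  have "continuous_on UNIV (\<lambda>x. (\<lambda>(t, x). f t x) (u, x))"
    using assms(2) by (intro continuous_on_compose2[OF assms(1)] continuous_intros) auto
  then show "continuous_on UNIV (f u)" by simp
qed

lemma s_adapted: "u \<in> {0..T} \<Longrightarrow> (\<lambda>\<omega>. s u (X u \<omega>)) \<in> borel_measurable (F u)"
  using X_adapted section_measurable[OF s_cont] by (rule measurable_compose)

lemma b_measurable: "u \<in> {0..T} \<Longrightarrow> (\<lambda>\<omega>. b u (X u \<omega>)) \<in> borel_measurable M"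
  using X_measurable section_measurable[OF b_cont] by (rule measurable_compose)

lemma b_path_cont:
  assumes "\<omega> \<in> space M"
  shows "continuous_on {0..T} (\<lambda>u. b u (X u \<omega>))"
proof -
  have "continuous_on {0..T} (\<lambda>u. (\<lambda>(t, x). b t x) (u, X u \<omega>))"
    by (intro continuous_on_compose2[OF b_cont] continuous_intros X_cont assms) auto
  then show ?thesis by simp
qed

lemma drift_measurable: "t \<in> {0..T} \<Longrightarrow> (\<lambda>\<omega>. integral {0..t} (\<lambda>u. b u (X u \<omega>))) \<in> borel_measurable M"
  by (intro borel_measurable_integral_path b_measurable continuous_on_subset[OF b_path_cont]) auto

lemma noise_measurable: "t \<in> {0..T} \<Longrightarrow> noise t \<in> borel_measurable M"
  unfolding noise_def[abs_def]
  using T_pos by (intro borel_measurable_diff X_measurable drift_measurable) auto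

lemma noise_0: "noise 0 \<omega> = 0"
  by (simp add: noise_def)

lemma ito_noise: "t \<in> {0..T} \<Longrightarrow> ito_integral_is M (\<lambda>u \<omega>. s u (X u \<omega>)) W 0 t (noise t)"
  using sol unfolding sde_solution_def noise_def[abs_def] by blast

text \<open>A single cell with weight one, where the weighted sum is
  \<open>noise t - noise 0 = noise t\<close>.\<close>

lemma noise_localised_moment:
  assumes t: "0 < t" "t \<le> T" and m: "m > 0" and K: "K \<ge> 0"
    and H': "\<And>u. u \<in> {0..t} \<Longrightarrow> H' u \<in> borel_measurable (F u)"
    and A: "A \<in> sets M" and eq: "\<And>\<omega> u. \<omega> \<in> A \<Longrightarrow> u \<in> {0..t} \<Longrightarrow> H' u \<omega> = s u (X u \<omega>)"
    and mom: "\<And>u. u \<in> {0..t} \<Longrightarrow> (\<integral>\<^sup>+ \<omega>. ennreal (H' u \<omega> ^ (2 * m)) \<partial>M) \<le> ennreal K"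
  shows "(\<integral>\<^sup>+ \<omega>. ennreal ((indicator A \<omega> * noise t \<omega>) ^ (2 * m)) \<partial>M) \<le> ennreal (mart_const m * (t ^ m * K))"
  using ito_weighted_increments_moment[OF filt BM t m, of 1 K "\<lambda>u \<omega>. s u (X u \<omega>)" H' A noise "\<lambda>l. 1" 1]
    K H' A eq mom t s_adapted ito_noise noise_measurable
  by (simp add: noise_0)

text \<open>No localisation here: the event is the whole space and the integrand is the coefficient
  itself.\<close>

lemma noise_weighted_moment:
  assumes m: "m > 0" and R: "R > 0" and K: "K \<ge> 0"
    and mom: "\<And>u. u \<in> {0..T} \<Longrightarrow> (\<integral>\<^sup>+ \<omega>. ennreal (s u (X u \<omega>) ^ (2 * m)) \<partial>M) \<le> ennreal K"
    and w: "\<And>l. l < R \<Longrightarrow> \<bar>w l\<bar> \<le> B"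
  shows "(\<integral>\<^sup>+ \<omega>. ennreal ((\<Sum>l<R. w l * (noise (real (Suc l) * (T / real R)) \<omega> - noise (real l * (T / real R)) \<omega>)) ^ (2 * m)) \<partial>M)
    \<le> ennreal (mart_const m * (T ^ m * (B ^ (2 * m) * K)))"
proof -
  have "(\<integral>\<^sup>+ \<omega>. ennreal ((indicator (space M) \<omega> *
      (\<Sum>l<R. w l * (noise (real (Suc l) * (T / real R)) \<omega> - noise (real l * (T / real R)) \<omega>))) ^ (2 * m)) \<partial>M)
    \<le> ennreal (mart_const m * (T ^ m * (B ^ (2 * m) * K)))"
    by (rule ito_weighted_increments_moment[OF filt BM T_pos order_refl m R K s_adapted s_adapted])
      (use mom w ito_noise noise_measurable noise_0 in auto)
  then show ?thesis by (simp cong: nn_integral_cong)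
qed

text \<open>The noise contributes the order \<open>t ^ m\<close>, which dominates for small t; the
  drift contributes \<open>t ^ (2 * m)\<close>.\<close>

lemma increment_moment:
  assumes t: "0 < t" "t \<le> T" and m: "m > 0" and K: "Kb \<ge> 0" "Ks \<ge> 0"
    and bmom: "\<And>u. u \<in> {0..T} \<Longrightarrow> (\<integral>\<^sup>+ \<omega>. ennreal (b u (X u \<omega>) ^ (2 * m)) \<partial>M) \<le> ennreal Kb"
    and smom: "\<And>u. u \<in> {0..T} \<Longrightarrow> (\<integral>\<^sup>+ \<omega>. ennreal (s u (X u \<omega>) ^ (2 * m)) \<partial>M) \<le> ennreal Ks"
  shows "(\<integral>\<^sup>+ \<omega>. ennreal ((X t \<omega> - X 0 \<omega>) ^ (2 * m)) \<partial>M)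
    \<le> ennreal (4 ^ m * (mart_const m * (t ^ m * Ks) + t ^ (2 * m) * Kb))"
proof -
  have "(\<integral>\<^sup>+ \<omega>. ennreal ((indicator (space M) \<omega> * noise t \<omega>) ^ (2 * m)) \<partial>M) \<le> ennreal (mart_const m * (t ^ m * Ks))"
    by (rule noise_localised_moment[OF t m K(2) s_adapted]) (use smom t in auto)
  then have n: "(\<integral>\<^sup>+ \<omega>. ennreal (noise t \<omega> ^ (2 * m)) \<partial>M) \<le> ennreal (mart_const m * (t ^ m * Ks))"
    by (simp cong: nn_integral_cong)
  have d: "(\<integral>\<^sup>+ \<omega>. ennreal (integral {0..t} (\<lambda>u. b u (X u \<omega>)) ^ (2 * m)) \<partial>M) \<le> ennreal (t ^ (2 * m) * Kb)"
    using t by (intro nn_moment_time_integral[OF b_measurable continuous_on_subset[OF b_path_cont] bmom _ m K(1)]) auto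
  have "(\<integral>\<^sup>+ \<omega>. ennreal ((noise t \<omega> + integral {0..t} (\<lambda>u. b u (X u \<omega>))) ^ (2 * m)) \<partial>M)
      \<le> ennreal (4 ^ m * (mart_const m * (t ^ m * Ks) + t ^ (2 * m) * Kb))"
    using t K mart_const_pos[of m] by (intro nn_moment_add n d noise_measurable drift_measurable) auto
  then show ?thesis by (simp add: noise_def)
qed

text \<open>Refine each cell of the coarse grid into \<open>N\<close> cells. The difference of the fine and the coarse
  Riemann sum is then a sum of increments of \<open>X\<close> with deterministic weights of size at most the
  coarse mesh, so the noise contributes as much as the drift. Finally \<open>N\<close> tends to infinity.\<close>
lemma quadrature_moment:
  assumes m: "m > 0" and K: "Kb \<ge> 0" "Ks \<ge> 0" and n: "n > 0"
    and bmom: "\<And>u. u \<in> {0..T} \<Longrightarrow> (\<integral>\<^sup>+ \<omega>. ennreal (b u (X u \<omega>) ^ (2 * m)) \<partial>M) \<le> ennreal Kb"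
    and smom: "\<And>u. u \<in> {0..T} \<Longrightarrow> (\<integral>\<^sup>+ \<omega>. ennreal (s u (X u \<omega>) ^ (2 * m)) \<partial>M) \<le> ennreal Ks"
  shows "(\<integral>\<^sup>+ \<omega>. ennreal ((integral {0..T} (\<lambda>u. X u \<omega>) - (\<Sum>i<n. X (real i * (T / real n)) \<omega> * (T / real n))) ^ (2 * m)) \<partial>M)
    \<le> ennreal (4 ^ m * (mart_const m * (T ^ m * Ks) + T ^ (2 * m) * Kb) * (T / real n) ^ (2 * m))"
proof -
  define h where "h = T / real n"
  have h: "h > 0" using T_pos n by (simp add: h_def)
  \<comment> \<open>The weights of the increments are bounded by h, and this bound enters the noise
    estimate as \<open>h ^ (2 * m)\<close>; the same factor multiplies the drift.\<close>
  define C where "C = 4 ^ m * (mart_const m * (T ^ m * (h ^ (2 * m) * Ks)) + h ^ (2 * m) * (T ^ (2 * m) * Kb))"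
  define coarse where "coarse = (\<lambda>\<omega>. \<Sum>i<n. X (real i * h) \<omega> * h)"
  define refined where "refined = (\<lambda>N \<omega>. \<Sum>j<n * Suc N. X (real j * (T / real (n * Suc N))) \<omega> * (T / real (n * Suc N)))"
  have coarse_meas: "coarse \<in> borel_measurable M"
    unfolding coarse_def h_def
    using grid_mem[of T _ n] T_pos by (intro borel_measurable_sum borel_measurable_times X_measurable) (auto simp: less_imp_le)
  have refined_meas: "refined N \<in> borel_measurable M" for N
    unfolding refined_def
    using grid_mem[of T _ "n * Suc N"] T_pos
    by (intro borel_measurable_sum borel_measurable_times X_measurable) (auto simp del: of_nat_mult mult_Suc_right)
  have bound: "(\<integral>\<^sup>+ \<omega>. ennreal ((refined N \<omega> - coarse \<omega>) ^ (2 * m)) \<partial>M) \<le> ennreal C" for N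
  proof -
    define P where "P = n * Suc N"
    define \<delta> where "\<delta> = T / real P"
    have P: "P > 0" using n by (simp add: P_def)
    have \<delta>: "\<delta> > 0" "real P * \<delta> = T" using P T_pos by (auto simp: \<delta>_def)
    have h\<delta>: "h = real (Suc N) * \<delta>" using n by (simp add: h_def \<delta>_def P_def del: of_nat_Suc mult_Suc_right)
    define w where "w = (\<lambda>l. \<delta> * (real (Suc N) - 1 - real (l mod Suc N)))"
    have w: "\<bar>w l\<bar> \<le> h" for l
    proof -
      have "l mod Suc N < Suc N" by simp
      then have "\<bar>real (Suc N) - 1 - real (l mod Suc N)\<bar> \<le> real (Suc N)" by linarith
      then have "\<delta> * \<bar>real (Suc N) - 1 - real (l mod Suc N)\<bar> \<le> \<delta> * real (Suc N)"
        using \<delta> by (intro mult_left_mono) auto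
      then show ?thesis using \<delta> unfolding w_def h\<delta> by (simp add: abs_mult mult.commute del: of_nat_Suc)
    qed
    define Z where "Z = (\<lambda>\<omega>. \<Sum>l<P. w l * (noise (real (Suc l) * \<delta>) \<omega> - noise (real l * \<delta>) \<omega>))"
    have mem: "real l * \<delta> \<in> {0..T}" if "l \<le> P" for l
      using grid_mem[of T l P] T_pos that by (simp add: \<delta>_def)
    have Z_meas: "Z \<in> borel_measurable M"
      unfolding Z_def by (intro borel_measurable_sum borel_measurable_times borel_measurable_diff noise_measurable mem) auto
    let ?I = "\<lambda>\<omega>. integral {0..T} (\<lambda>u. \<bar>b u (X u \<omega>)\<bar>)"
    have pt: "(refined N \<omega> - coarse \<omega>) ^ (2 * m) \<le> (\<bar>Z \<omega>\<bar> + h * ?I \<omega>) ^ (2 * m)" if \<omega>: "\<omega> \<in> space M" for \<omega>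
    proof -
      let ?D = "\<lambda>l. integral {real l * \<delta>..real (Suc l) * \<delta>} (\<lambda>u. b u (X u \<omega>))"
      have X_incr: "X (real (Suc l) * \<delta>) \<omega> - X (real l * \<delta>) \<omega>
          = (noise (real (Suc l) * \<delta>) \<omega> - noise (real l * \<delta>) \<omega>) + ?D l" if "l < P" for l
      proof -
        have "real l * \<delta> \<le> real (Suc l) * \<delta>" using \<delta> by simp
        moreover have "(\<lambda>u. b u (X u \<omega>)) integrable_on {0..real (Suc l) * \<delta>}"
          using mem[of "Suc l"] that
          by (intro integrable_continuous_real continuous_on_subset[OF b_path_cont[OF \<omega>]]) auto
        ultimately have "integral {0..real l * \<delta>} (\<lambda>u. b u (X u \<omega>)) + ?D l
            = integral {0..real (Suc l) * \<delta>} (\<lambda>u. b u (X u \<omega>))"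
          using \<delta> by (intro Henstock_Kurzweil_Integration.integral_combine) auto
        then show ?thesis by (simp add: noise_def)
      qed
      have "refined N \<omega> - coarse \<omega> = (\<Sum>j<n * Suc N. X (real j * \<delta>) \<omega> * \<delta>)
          - (\<Sum>i<n. X (real (i * Suc N) * \<delta>) \<omega> * (real (Suc N) * \<delta>))"
      proof -
        have "real (i * Suc N) * \<delta> = real i * h" for i by (simp add: h\<delta> del: of_nat_Suc mult_Suc_right)
        then show ?thesis by (simp only: refined_def coarse_def P_def[symmetric] \<delta>_def[symmetric] h\<delta>[symmetric])
      qed
      also have "\<dots> = (\<Sum>l<P. w l * (X (real (Suc l) * \<delta>) \<omega> - X (real l * \<delta>) \<omega>))"
        unfolding P_def w_def by (rule sum_fine_minus_coarse)
      also have "\<dots> = Z \<omega> + (\<Sum>l<P. w l * ?D l)"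
        unfolding Z_def sum.distrib[symmetric] by (intro sum.cong refl) (simp only: X_incr lessThan_iff distrib_left)
      finally have eq: "refined N \<omega> - coarse \<omega> = Z \<omega> + (\<Sum>l<P. w l * ?D l)" .
      have "\<bar>\<Sum>l<P. w l * ?D l\<bar> \<le> (\<Sum>l<P. h * integral {real l * \<delta>..real (Suc l) * \<delta>} (\<lambda>u. \<bar>b u (X u \<omega>)\<bar>))"
      proof (intro order_trans[OF sum_abs] sum_mono)
        fix l assume "l \<in> {..<P}"
        then have sub: "{real l * \<delta>..real (Suc l) * \<delta>} \<subseteq> {0..T}"
          using mem[of l] mem[of "Suc l"] by auto
        have "continuous_on {real l * \<delta>..real (Suc l) * \<delta>} (\<lambda>u. b u (X u \<omega>))"
          using b_path_cont[OF \<omega>] sub by (rule continuous_on_subset)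
        then have "norm (?D l) \<le> integral {real l * \<delta>..real (Suc l) * \<delta>} (\<lambda>u. \<bar>b u (X u \<omega>)\<bar>)"
          by (intro integral_norm_bound_integral integrable_continuous_real continuous_intros) auto
        then show "\<bar>w l * ?D l\<bar> \<le> h * integral {real l * \<delta>..real (Suc l) * \<delta>} (\<lambda>u. \<bar>b u (X u \<omega>)\<bar>)"
          using w[of l] h unfolding abs_mult by (intro mult_mono) auto
      qed
      also have "\<dots> = h * ?I \<omega>"
        using integral_uniform_partition[of T "\<lambda>u. \<bar>b u (X u \<omega>)\<bar>" \<delta> P] b_path_cont[OF \<omega>] \<delta>
        by (simp add: sum_distrib_left continuous_on_rabs)
      finally have "\<bar>refined N \<omega> - coarse \<omega>\<bar> \<le> \<bar>Z \<omega>\<bar> + h * ?I \<omega>" unfolding eq by linarith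
      then have "\<bar>refined N \<omega> - coarse \<omega>\<bar> ^ (2 * m) \<le> (\<bar>Z \<omega>\<bar> + h * ?I \<omega>) ^ (2 * m)"
        by (intro power_mono) auto
      then show ?thesis by (simp add: power_even_abs)
    qed
    have "(\<integral>\<^sup>+ \<omega>. ennreal ((refined N \<omega> - coarse \<omega>) ^ (2 * m)) \<partial>M)
        \<le> (\<integral>\<^sup>+ \<omega>. ennreal ((\<bar>Z \<omega>\<bar> + h * ?I \<omega>) ^ (2 * m)) \<partial>M)"
      by (intro nn_integral_mono ennreal_leI pt)
    also have "\<dots> \<le> ennreal C"
      unfolding C_def
    proof (rule nn_moment_add)
      have I_meas: "?I \<in> borel_measurable M"
        using T_pos by (intro borel_measurable_integral_path borel_measurable_abs b_measurable continuous_on_rabs b_path_cont) auto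
      then show "(\<lambda>\<omega>. h * ?I \<omega>) \<in> borel_measurable M" by simp
      have "(\<integral>\<^sup>+ \<omega>. ennreal (?I \<omega> ^ (2 * m)) \<partial>M) \<le> ennreal (T ^ (2 * m) * Kb)"
        using T_pos bmom m K
        by (intro nn_moment_time_integral borel_measurable_abs b_measurable continuous_on_rabs b_path_cont)
          (auto simp: power_even_abs)
      then show "(\<integral>\<^sup>+ \<omega>. ennreal ((h * ?I \<omega>) ^ (2 * m)) \<partial>M) \<le> ennreal (h ^ (2 * m) * (T ^ (2 * m) * Kb))"
        using K T_pos by (intro nn_moment_cmult I_meas) auto
      show "(\<integral>\<^sup>+ \<omega>. ennreal (\<bar>Z \<omega>\<bar> ^ (2 * m)) \<partial>M) \<le> ennreal (mart_const m * (T ^ m * (h ^ (2 * m) * Ks)))"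
        using noise_weighted_moment[OF m P K(2) smom, of w h] w
        by (simp add: power_even_abs Z_def \<delta>_def del: of_nat_Suc)
    qed (use Z_meas K T_pos mart_const_pos[of m] in auto)
    finally show ?thesis .
  qed
  have "(\<integral>\<^sup>+ \<omega>. ennreal ((integral {0..T} (\<lambda>u. X u \<omega>) - coarse \<omega>) ^ (2 * m)) \<partial>M) \<le> ennreal C"
  proof (rule nn_moment_fatou[OF _ _ bound])
    show "(\<lambda>\<omega>. refined N \<omega> - coarse \<omega>) \<in> borel_measurable M" for N
      using refined_meas coarse_meas by simp
    show "AE \<omega> in M. (\<lambda>N. refined N \<omega> - coarse \<omega>) \<longlonglongrightarrow> integral {0..T} (\<lambda>u. X u \<omega>) - coarse \<omega>"
    proof (intro AE_I2 tendsto_diff tendsto_const)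
      fix \<omega> assume \<omega>: "\<omega> \<in> space M"
      have "filterlim (\<lambda>N. n * Suc N) at_top sequentially"
      proof (rule filterlim_at_top_mono[OF filterlim_Suc])
        have "1 * Suc i \<le> n * Suc i" for i using n by (intro mult_le_mono1) simp
        then show "eventually (\<lambda>i. Suc i \<le> n * Suc i) sequentially"
          by (intro always_eventually allI) (simp only: mult_1)
      qed
      from filterlim_compose[OF riemann_sum_tendsto[OF X_cont[OF \<omega>] less_imp_le[OF T_pos]] this]
      show "(\<lambda>N. refined N \<omega>) \<longlonglongrightarrow> integral {0..T} (\<lambda>u. X u \<omega>)"
        by (simp only: refined_def)
    qed
  qed
  also have "C = 4 ^ m * (mart_const m * (T ^ m * Ks) + T ^ (2 * m) * Kb) * (T / real n) ^ (2 * m)"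
    by (simp add: C_def h_def[symmetric] algebra_simps)
  finally show ?thesis by (simp only: coarse_def h_def)
qed

end

subsection \<open>Moments of the variance process\<close>

text \<open>In HOL \<open>sqrt\<close> is continuous on the whole real line, being extended as an
  odd function, so \<open>\<sigma> * sqrt x\<close> meets the continuity requirement of
  \<open>sde\<close> for all real x; nonnegativity of V is a separate assumption.\<close>

locale cir = sde M F T "\<lambda>t x. k * (\<theta> - x)" "\<lambda>t x. \<sigma> * sqrt x" W V
  for M :: "'a measure" and F T and k \<theta> \<sigma> :: real and W V +
  fixes V0 :: real
  assumes params: "k > 0" "\<theta> > 0" "\<sigma> > 0" "V0 > 0"
    and V_init: "\<And>\<omega>. \<omega> \<in> space M \<Longrightarrow> V 0 \<omega> = V0"
    and V_nonneg: "\<And>t \<omega>. t \<in> {0..T} \<Longrightarrow> \<omega> \<in> space M \<Longrightarrow> V t \<omega> \<ge> 0"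
begin

text \<open>The event that t has not passed the first time at which V exceeds L, expressed without a
  stopping time. It shrinks as t grows, so on it an integrand cut off at any earlier time agrees
  with the original one.\<close>

definition below :: "real \<Rightarrow> real \<Rightarrow> 'a set" where
  "below L t = {\<omega> \<in> space M. \<forall>u\<in>{0..t}. V u \<omega> \<le> L}"

text \<open>By continuity of the paths the condition at all times follows from the rational ones, of
  which there are countably many; adaptedness then puts the event into \<open>F t\<close>.\<close>

lemma below_measurable:
  assumes t: "t \<in> {0..T}"
  shows "below L t \<in> sets (F t)"
proof -
  have sp: "space (F t) = space M" using subalg by (simp add: subalgebra_def)
  have "below L t = {\<omega> \<in> space (F t). \<forall>q::rat. of_rat q \<in> {0..t} \<longrightarrow> V (of_rat q) \<omega> \<le> L}" (is "_ = ?B")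
  proof (intro equalityI subsetI)
    fix \<omega> assume B: "\<omega> \<in> ?B"
    then have \<omega>: "\<omega> \<in> space M" by (simp add: sp)
    have "V u \<omega> \<le> L" if u: "u \<in> {0..t}" for u
    proof (rule ccontr)
      assume gt: "\<not> V u \<omega> \<le> L"
      show False
      \<comment> \<open>For \<open>t = 0\<close> there is no open interval to search, but the single
        time 0 is itself rational.\<close>
      proof (cases "t = 0")
        case True
        then show False using B gt u by (auto dest: spec[of _ 0])
      next
        case False
        have "continuous_on {0..T} (\<lambda>u. V u \<omega>)" by (rule X_cont[OF \<omega>])
        then obtain d where d: "d > 0" "\<And>v. v \<in> {0..T} \<Longrightarrow> dist v u < d \<Longrightarrow> dist (V v \<omega>) (V u \<omega>) < V u \<omega> - L"
          unfolding continuous_on_iff using u t gt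
          by (elim ballE[where x = u] allE[where x = "V u \<omega> - L"]) auto
        \<comment> \<open>The intervals (0, t) and (u - d, u + d) meet even when u is an endpoint,
          so an irrational t causes no trouble.\<close>
        have "max 0 (u - d) < min t (u + d)"
          using u t d(1) False by auto
        then obtain q :: rat where q: "max 0 (u - d) < of_rat q" "of_rat q < min t (u + d)"
          using Rats_dense_in_real by (metis Rats_cases)
        then have "dist (V (of_rat q) \<omega>) (V u \<omega>) < V u \<omega> - L"
          using t by (intro d(2)) (auto simp: dist_real_def)
        moreover have "V (of_rat q) \<omega> \<le> L" using B q by auto
        ultimately show False by (auto simp: dist_real_def)
      qed
    qed
    then show "\<omega> \<in> below L t" using \<omega> by (simp add: below_def)
  qed (auto simp: below_def sp)
  also have "?B \<in> sets (F t)"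
  proof (intro sets.sets_Collect_countable_All)
    fix q :: rat
    \<comment> \<open>Rational times outside [0, t] are sent to 0, where V is measurable; the
      condition is vacuous for them.\<close>
    define u where "u = (if of_rat q \<in> {0..t} then of_rat q else 0 :: real)"
    have u: "u \<in> {0..t}" using t by (simp add: u_def)
    then have "V u \<in> borel_measurable (F u)" "sets (F u) \<subseteq> sets (F t)"
      using X_adapted[of u] t filt unfolding is_filtration_def by simp_all
    then have "V u \<in> borel_measurable (F t)"
      using subalg[of u] subalg[of t] unfolding measurable_def subalgebra_def by auto
    then have "{\<omega> \<in> space (F t). of_rat q \<in> {0..t} \<longrightarrow> V u \<omega> \<le> L} \<in> sets (F t)" by measurable
    then show "{\<omega> \<in> space (F t). of_rat q \<in> {0..t} \<longrightarrow> V (of_rat q) \<omega> \<le> L} \<in> sets (F t)"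
      by (cases "of_rat q \<in> {0..t}") (simp_all only: u_def if_True simp_thms)
  qed
  finally show ?thesis .
qed

lemma below_events: "t \<in> {0..T} \<Longrightarrow> below L t \<in> sets M"
  using below_measurable subalg by (meson subalgebra_def subsetD)

text \<open>Continuous paths are bounded on [0, t], so the localising events exhaust the space along
  integer levels.\<close>

lemma ex_below:
  assumes "\<omega> \<in> space M" "t \<in> {0..T}"
  shows "\<exists>n0. \<forall>n\<ge>n0. \<omega> \<in> below (real n) t"
proof -
  have "compact ((\<lambda>u. V u \<omega>) ` {0..t})"
    using assms by (intro compact_continuous_image continuous_on_subset[OF X_cont[OF assms(1)]]) auto
  then have "bounded ((\<lambda>u. V u \<omega>) ` {0..t})" by (rule compact_imp_bounded)
  then obtain c where c: "\<forall>x\<in>(\<lambda>u. V u \<omega>) ` {0..t}. \<bar>x\<bar> \<le> c"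
    unfolding bounded_iff by auto
  obtain n0 :: nat where n0: "c \<le> real n0" using real_arch_simple by blast
  have "V u \<omega> \<le> real n" if "n \<ge> n0" "u \<in> {0..t}" for n u
  proof -
    have "\<bar>V u \<omega>\<bar> \<le> c" using c that by auto
    then show ?thesis using n0 that(1) by linarith
  qed
  then show ?thesis using assms(1) by (intro exI[of _ n0]) (simp add: below_def)
qed

text \<open>The mean reversion \<open>- k * V\<close> is nonpositive and is dropped; what remains
  involves V only through the noise.\<close>

lemma V_le_noise:
  assumes \<omega>: "\<omega> \<in> space M" and t: "t \<in> {0..T}"
  shows "V t \<omega> \<le> V0 + k * \<theta> * T + \<bar>noise t \<omega>\<bar>"
proof -
  have "integral {0..t} (\<lambda>u. k * (\<theta> - V u \<omega>)) \<le> integral {0..t} (\<lambda>u. k * \<theta>)"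
  proof (rule integral_le)
    show "(\<lambda>u. k * (\<theta> - V u \<omega>)) integrable_on {0..t}"
      using t by (intro integrable_continuous_real continuous_on_subset[OF b_path_cont[OF \<omega>]]) auto
    fix u assume u: "u \<in> {0..t}"
    then have "0 \<le> V u \<omega>" using t by (intro V_nonneg \<omega>) auto
    then show "k * (\<theta> - V u \<omega>) \<le> k * \<theta>" using params by simp
  qed auto
  also have "\<dots> = k * \<theta> * t" using t by simp
  also have "\<dots> \<le> k * \<theta> * T" using t params by (intro mult_left_mono) auto
  finally show ?thesis
    using V_init[OF \<omega>] by (simp add: noise_def)
qed

text \<open>The drift only helps, as \<open>V \<ge> 0\<close>. On the event \<open>V \<le> L\<close> the supremum \<open>S\<close> of the moment is finite, and since the
  squared diffusion coefficient is linear in \<open>V\<close>, the noise estimate gives \<open>S \<le> E + S / 2\<close> with \<open>E\<close>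
  not depending on \<open>L\<close>.\<close>
lemma V_moment_below:
  assumes m: "m > 0"
  shows "\<exists>K\<ge>0. \<forall>n::nat. \<forall>t\<in>{0..T}. (\<integral>\<^sup>+ \<omega>. ennreal ((indicator (below (real n) t) \<omega> * V t \<omega>) ^ (2 * m)) \<partial>M) \<le> ennreal K"
proof -
  define c where "c = V0 + k * \<theta> * T"
  have c: "c \<ge> 0" using params T_pos by (simp add: c_def)
  define Mc where "Mc = 4 ^ m * mart_const m * T ^ m"
  have Mc: "Mc > 0" using mart_const_pos[of m] T_pos by (simp add: Mc_def)
  \<comment> \<open>Chosen to make \<open>Mc * \<eta> = 1 / 2\<close>, the share of S on the
    right-hand side.\<close>
  define \<eta> where "\<eta> = 1 / (2 * Mc)"
  have \<eta>: "\<eta> > 0" using Mc by (simp add: \<eta>_def)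
  \<comment> \<open>Collects the deterministic part c and the remainder of Young's inequality
    \<open>s * y \<le> \<eta> * y\<^sup>2 + s\<^sup>2 / (4 * \<eta>)\<close>, used with
    \<open>s = \<sigma> ^ (2 * m)\<close> and y the m-th power of V.\<close>
  define E where "E = 4 ^ m * c ^ (2 * m) + Mc * ((\<sigma> ^ (2 * m))\<^sup>2 / (4 * \<eta>))"
  have E: "E \<ge> 0" using c Mc \<eta> by (simp add: E_def)
  have "(\<integral>\<^sup>+ \<omega>. ennreal ((indicator (below (real n) t) \<omega> * V t \<omega>) ^ (2 * m)) \<partial>M) \<le> ennreal (2 * E)"
    if t: "t \<in> {0..T}" for n t
  proof -
    define f where "f = (\<lambda>t. \<integral>\<^sup>+ \<omega>. ennreal ((indicator (below (real n) t) \<omega> * V t \<omega>) ^ (2 * m)) \<partial>M)"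
    have f_le: "f t \<le> ennreal (real n ^ (2 * m))" if t: "t \<in> {0..T}" for t
    proof -
      have "f t \<le> (\<integral>\<^sup>+ \<omega>. ennreal (real n ^ (2 * m)) \<partial>M)"
        unfolding f_def
      proof (intro nn_integral_mono ennreal_leI)
        fix \<omega> assume \<omega>: "\<omega> \<in> space M"
        show "(indicator (below (real n) t) \<omega> * V t \<omega>) ^ (2 * m) \<le> real n ^ (2 * m)"
          using t V_nonneg[OF t \<omega>] by (intro power_mono) (auto simp: indicator_def below_def)
      qed
      then show ?thesis by (simp add: emeasure_space_1)
    qed
    define s where "s = (SUP t\<in>{0..T}. f t)"
    have "s \<le> ennreal (real n ^ (2 * m))"
      unfolding s_def by (intro SUP_least f_le)
    \<comment> \<open>Finiteness is what later permits cancelling S / 2; the size of this bound,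
      which grows with n, does not enter the result.\<close>
    then have "s < top" by (rule le_less_trans) simp
    then obtain S where S: "S \<ge> 0" "s = ennreal S"
      by (cases s) auto
    have f_S: "f t \<le> ennreal S" if "t \<in> {0..T}" for t
      using that unfolding S(2)[symmetric] s_def by (rule SUP_upper)
    have step: "f t \<le> ennreal (E + S / 2)" if t: "t \<in> {0..T}" for t
    \<comment> \<open>The noise estimate requires \<open>t > 0\<close>; at time 0 the deterministic
      initial value takes its place.\<close>
    proof (cases "t = 0")
      case True
      have "f t \<le> (\<integral>\<^sup>+ \<omega>. ennreal (c ^ (2 * m)) \<partial>M)"
        unfolding f_def
      proof (intro nn_integral_mono ennreal_leI)
        fix \<omega> assume \<omega>: "\<omega> \<in> space M"
        have "V0 \<le> c" using params T_pos by (simp add: c_def)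
        then show "(indicator (below (real n) t) \<omega> * V t \<omega>) ^ (2 * m) \<le> c ^ (2 * m)"
          using True V_init[OF \<omega>] params c by (intro power_mono) (auto simp: indicator_def)
      qed
      also have "\<dots> = ennreal (c ^ (2 * m))" by (simp add: emeasure_space_1)
      also have "\<dots> \<le> ennreal (E + S / 2)"
      proof (rule ennreal_leI)
        have "1 * c ^ (2 * m) \<le> 4 ^ m * c ^ (2 * m)"
          using c by (intro mult_right_mono) auto
        moreover have "0 \<le> Mc * ((\<sigma> ^ (2 * m))\<^sup>2 / (4 * \<eta>))" using Mc \<eta> by simp
        ultimately show "c ^ (2 * m) \<le> E + S / 2" using S(1) unfolding E_def by linarith
      qed
      finally show ?thesis .
    next
      case False
      then have t': "0 < t" "t \<le> T" using t by auto
      define K where "K = \<eta> * S + (\<sigma> ^ (2 * m))\<^sup>2 / (4 * \<eta>)"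
      have K: "K \<ge> 0" using \<eta> S by (simp add: K_def)
      \<comment> \<open>The cut-off at u uses the event at time u and not at time t, which keeps H
        adapted; on \<open>below (real n) t\<close> it has no effect.\<close>
      define H where "H = (\<lambda>u \<omega>. \<sigma> * sqrt (V u \<omega>) * indicator (below (real n) u) \<omega>)"
      have H_mom: "(\<integral>\<^sup>+ \<omega>. ennreal (H u \<omega> ^ (2 * m)) \<partial>M) \<le> ennreal K" if u: "u \<in> {0..t}" for u
      proof -
        have uT: "u \<in> {0..T}" using u t by auto
        have [measurable]: "V u \<in> borel_measurable M" "below (real n) u \<in> sets M"
          using X_measurable[OF uT] below_events[OF uT] by auto
        have "(\<integral>\<^sup>+ \<omega>. ennreal (H u \<omega> ^ (2 * m)) \<partial>M)
            \<le> (\<integral>\<^sup>+ \<omega>. ennreal \<eta> * ennreal ((indicator (below (real n) u) \<omega> * V u \<omega>) ^ (2 * m))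
                + ennreal ((\<sigma> ^ (2 * m))\<^sup>2 / (4 * \<eta>)) \<partial>M)"
        proof (rule nn_integral_mono)
          fix \<omega> assume \<omega>: "\<omega> \<in> space M"
          let ?x = "indicator (below (real n) u) \<omega> * V u \<omega>"
          have x: "?x \<ge> 0" using V_nonneg[OF uT \<omega>] by simp
          have "H u \<omega> = \<sigma> * sqrt ?x" by (simp add: H_def indicator_def)
          then have "H u \<omega> ^ (2 * m) = \<sigma> ^ (2 * m) * ?x ^ m"
            using x by (simp add: power_mult_distrib power_mult[of "sqrt _"])
          also have "\<dots> \<le> \<eta> * ?x ^ (2 * m) + (\<sigma> ^ (2 * m))\<^sup>2 / (4 * \<eta>)"
          proof -
            have "0 \<le> (2 * \<eta> * ?x ^ m - \<sigma> ^ (2 * m))\<^sup>2 / (4 * \<eta>)" using \<eta> by simp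
            also have "\<dots> = \<eta> * (?x ^ m)\<^sup>2 + (\<sigma> ^ (2 * m))\<^sup>2 / (4 * \<eta>) - \<sigma> ^ (2 * m) * ?x ^ m"
              using \<eta> by (simp add: power2_diff power_mult_distrib diff_divide_distrib add_divide_distrib)
                (simp add: power2_eq_square)
            also have "(?x ^ m)\<^sup>2 = ?x ^ (2 * m)" by (simp add: power_mult[symmetric] mult.commute)
            finally show ?thesis by simp
          qed
          finally have "ennreal (H u \<omega> ^ (2 * m)) \<le> ennreal (\<eta> * ?x ^ (2 * m) + (\<sigma> ^ (2 * m))\<^sup>2 / (4 * \<eta>))"
            by (rule ennreal_leI)
          also have "\<dots> = ennreal \<eta> * ennreal (?x ^ (2 * m)) + ennreal ((\<sigma> ^ (2 * m))\<^sup>2 / (4 * \<eta>))"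
            using \<eta> by (simp add: ennreal_mult[symmetric] ennreal_plus[symmetric] del: ennreal_plus)
          finally show "ennreal (H u \<omega> ^ (2 * m)) \<le> ennreal \<eta> * ennreal (?x ^ (2 * m)) + ennreal ((\<sigma> ^ (2 * m))\<^sup>2 / (4 * \<eta>))" .
        qed
        also have "\<dots> = ennreal \<eta> * f u + ennreal ((\<sigma> ^ (2 * m))\<^sup>2 / (4 * \<eta>))"
          by (subst nn_integral_add) (auto simp: f_def nn_integral_cmult emeasure_space_1)
        also have "\<dots> \<le> ennreal \<eta> * ennreal S + ennreal ((\<sigma> ^ (2 * m))\<^sup>2 / (4 * \<eta>))"
          by (intro add_right_mono mult_left_mono f_S uT) simp
        also have "\<dots> = ennreal K"
          using \<eta> S(1) by (simp add: K_def ennreal_mult[symmetric] ennreal_plus[symmetric] del: ennreal_plus)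
        finally show ?thesis .
      qed
      have noise: "(\<integral>\<^sup>+ \<omega>. ennreal ((indicator (below (real n) t) \<omega> * noise t \<omega>) ^ (2 * m)) \<partial>M)
          \<le> ennreal (mart_const m * (t ^ m * K))"
      proof (rule noise_localised_moment[OF t' m K _ below_events[OF t] _ H_mom])
        fix u assume u: "u \<in> {0..t}"
        then have "u \<in> {0..T}" using t by auto
        then show "H u \<in> borel_measurable (F u)"
          unfolding H_def by (intro borel_measurable_times borel_measurable_indicator below_measurable s_adapted)
        show "H u \<omega> = \<sigma> * sqrt (V u \<omega>)" if "\<omega> \<in> below (real n) t" for \<omega>
          using that u by (auto simp: H_def below_def)
      qed
      let ?Y = "\<lambda>\<omega>. \<bar>indicator (below (real n) t) \<omega> * noise t \<omega>\<bar>"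
      have "f t \<le> (\<integral>\<^sup>+ \<omega>. ennreal ((c + ?Y \<omega>) ^ (2 * m)) \<partial>M)"
        unfolding f_def
      proof (intro nn_integral_mono ennreal_leI)
        fix \<omega> assume \<omega>: "\<omega> \<in> space M"
        have "indicator (below (real n) t) \<omega> * V t \<omega> \<le> c + ?Y \<omega>"
          using V_le_noise[OF \<omega> t] c by (auto simp: indicator_def c_def)
        then show "(indicator (below (real n) t) \<omega> * V t \<omega>) ^ (2 * m) \<le> (c + ?Y \<omega>) ^ (2 * m)"
          using V_nonneg[OF t \<omega>] by (intro power_mono) auto
      qed
      also have "\<dots> \<le> ennreal (4 ^ m * (c ^ (2 * m) + mart_const m * (t ^ m * K)))"
        using noise below_events[OF t] noise_measurable[OF t] K t mart_const_pos[of m] c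
        by (intro nn_moment_add) (auto simp: power_even_abs emeasure_space_1)
      also have "\<dots> \<le> ennreal (4 ^ m * (c ^ (2 * m) + mart_const m * (T ^ m * K)))"
        using t K mart_const_pos[of m]
        by (intro ennreal_leI mult_left_mono add_left_mono mult_right_mono power_mono) auto
      also have "4 ^ m * (c ^ (2 * m) + mart_const m * (T ^ m * K)) = 4 ^ m * c ^ (2 * m) + Mc * K"
        by (simp add: Mc_def algebra_simps)
      also have "\<dots> = E + (Mc * \<eta>) * S"
        by (simp add: E_def K_def algebra_simps)
      also have "\<dots> = E + S / 2"
        using Mc by (simp add: \<eta>_def)
      finally show ?thesis .
    qed
    have "s \<le> ennreal (E + S / 2)"
      unfolding s_def by (intro SUP_least step)
    then have "S \<le> E + S / 2" using S E by (simp add: ennreal_plus[symmetric] del: ennreal_plus)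
    then have "S \<le> 2 * E" by simp
    then show ?thesis using f_S[OF t] by (auto simp: f_def intro: order_trans ennreal_leI)
  qed
  then show ?thesis using E by (intro exI[of _ "2 * E"]) auto
qed

text \<open>The localised bound does not depend on the level n, so Fatou removes the localisation as
  n grows.\<close>

lemma V_moment_even:
  assumes m: "m > 0"
  shows "\<exists>K\<ge>0. \<forall>t\<in>{0..T}. (\<integral>\<^sup>+ \<omega>. ennreal (V t \<omega> ^ (2 * m)) \<partial>M) \<le> ennreal K"
proof -
  obtain K where K: "K \<ge> 0" "\<And>n t. t \<in> {0..T} \<Longrightarrow>
      (\<integral>\<^sup>+ \<omega>. ennreal ((indicator (below (real n) t) \<omega> * V t \<omega>) ^ (2 * m)) \<partial>M) \<le> ennreal K"
    using V_moment_below[OF m] by blast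
  have "(\<integral>\<^sup>+ \<omega>. ennreal (V t \<omega> ^ (2 * m)) \<partial>M) \<le> ennreal K" if t: "t \<in> {0..T}" for t
  proof (rule nn_moment_fatou[OF _ _ K(2)[OF t]])
    show "(\<lambda>\<omega>. indicator (below (real n) t) \<omega> * V t \<omega>) \<in> borel_measurable M" for n
      using X_measurable[OF t] below_events[OF t] by measurable
    show "AE \<omega> in M. (\<lambda>n. indicator (below (real n) t) \<omega> * V t \<omega>) \<longlonglongrightarrow> V t \<omega>"
    proof (rule AE_I2)
      fix \<omega> assume "\<omega> \<in> space M"
      then have "eventually (\<lambda>n. indicator (below (real n) t) \<omega> * V t \<omega> = V t \<omega>) sequentially"
        using ex_below[OF _ t] unfolding eventually_sequentially by force
      then show "(\<lambda>n. indicator (below (real n) t) \<omega> * V t \<omega>) \<longlonglongrightarrow> V t \<omega>"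
        by (rule tendsto_eventually)
    qed
  qed
  then show ?thesis using K(1) by blast
qed

lemma drift_moment:
  assumes m: "m > 0"
  shows "\<exists>K\<ge>0. \<forall>t\<in>{0..T}. (\<integral>\<^sup>+ \<omega>. ennreal ((k * (\<theta> - V t \<omega>)) ^ (2 * m)) \<partial>M) \<le> ennreal K"
proof -
  obtain K where K: "K \<ge> 0" "\<And>t. t \<in> {0..T} \<Longrightarrow> (\<integral>\<^sup>+ \<omega>. ennreal (V t \<omega> ^ (2 * m)) \<partial>M) \<le> ennreal K"
    using V_moment_even[OF m] by blast
  let ?K = "4 ^ m * ((k * \<theta>) ^ (2 * m) + (- k) ^ (2 * m) * K)"
  have "(\<integral>\<^sup>+ \<omega>. ennreal ((k * (\<theta> - V t \<omega>)) ^ (2 * m)) \<partial>M) \<le> ennreal ?K" if t: "t \<in> {0..T}" for t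
  proof -
    have "(\<integral>\<^sup>+ \<omega>. ennreal ((k * \<theta> + - k * V t \<omega>) ^ (2 * m)) \<partial>M) \<le> ennreal ?K"
    proof (rule nn_moment_add)
      show "(\<integral>\<^sup>+ \<omega>. ennreal ((- k * V t \<omega>) ^ (2 * m)) \<partial>M) \<le> ennreal ((- k) ^ (2 * m) * K)"
        by (intro nn_moment_cmult X_measurable K t)
    qed (use X_measurable[OF t] K(1) in \<open>auto simp: emeasure_space_1\<close>)
    then show ?thesis by (simp add: algebra_simps)
  qed
  moreover have "?K \<ge> 0" using K(1) by simp
  ultimately show ?thesis by blast
qed

text \<open>The inequality \<open>sqrt x \<le> 1 + x\<close> for \<open>x \<ge> 0\<close> reduces
  the diffusion coefficient to the even moments of V.\<close>

lemma diffusion_moment: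
  assumes m: "m > 0"
  shows "\<exists>K\<ge>0. \<forall>t\<in>{0..T}. (\<integral>\<^sup>+ \<omega>. ennreal ((\<sigma> * sqrt (V t \<omega>)) ^ (2 * m)) \<partial>M) \<le> ennreal K"
proof -
  obtain K where K: "K \<ge> 0" "\<And>t. t \<in> {0..T} \<Longrightarrow> (\<integral>\<^sup>+ \<omega>. ennreal (V t \<omega> ^ (2 * m)) \<partial>M) \<le> ennreal K"
    using V_moment_even[OF m] by blast
  have "(\<integral>\<^sup>+ \<omega>. ennreal ((\<sigma> * sqrt (V t \<omega>)) ^ (2 * m)) \<partial>M) \<le> ennreal (\<sigma> ^ (2 * m) * (4 ^ m * (1 + K)))"
    if t: "t \<in> {0..T}" for t
  proof (rule nn_moment_cmult)
    have "(\<integral>\<^sup>+ \<omega>. ennreal (sqrt (V t \<omega>) ^ (2 * m)) \<partial>M) \<le> (\<integral>\<^sup>+ \<omega>. ennreal ((1 + V t \<omega>) ^ (2 * m)) \<partial>M)"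
    proof (intro nn_integral_mono ennreal_leI power_mono)
      fix \<omega> assume "\<omega> \<in> space M"
      then have "V t \<omega> \<ge> 0" by (rule V_nonneg[OF t])
      then show "sqrt (V t \<omega>) \<le> 1 + V t \<omega>" "0 \<le> sqrt (V t \<omega>)"
        by (auto intro!: real_le_lsqrt simp: power2_eq_square algebra_simps)
    qed
    also have "\<dots> \<le> ennreal (4 ^ m * (1 + K))"
      using X_measurable[OF t] K t by (intro nn_moment_add) (auto simp: emeasure_space_1)
    finally show "(\<integral>\<^sup>+ \<omega>. ennreal (sqrt (V t \<omega>) ^ (2 * m)) \<partial>M) \<le> ennreal (4 ^ m * (1 + K))" .
  qed (use X_measurable[OF t] K(1) in auto)
  moreover have "\<sigma> ^ (2 * m) * (4 ^ m * (1 + K)) \<ge> 0" using K(1) by simp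
  ultimately show ?thesis by blast
qed

text \<open>The drift term of order \<open>t ^ (2 * m)\<close> is absorbed by
  \<open>t \<le> T\<close>. The rate \<open>t ^ m\<close>, with m at will, is what beats the powers
  of \<open>2 ^ j\<close> in the negative moments.\<close>

lemma V_increment_moment:
  assumes m: "m > 0"
  shows "\<exists>C\<ge>0. \<forall>t\<in>{0<..T}. (\<integral>\<^sup>+ \<omega>. ennreal ((V t \<omega> - V0) ^ (2 * m)) \<partial>M) \<le> ennreal (C * t ^ m)"
proof -
  obtain Kb where Kb: "Kb \<ge> 0" "\<And>t. t \<in> {0..T} \<Longrightarrow> (\<integral>\<^sup>+ \<omega>. ennreal ((k * (\<theta> - V t \<omega>)) ^ (2 * m)) \<partial>M) \<le> ennreal Kb"
    using drift_moment[OF m] by blast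
  obtain Ks where Ks: "Ks \<ge> 0" "\<And>t. t \<in> {0..T} \<Longrightarrow> (\<integral>\<^sup>+ \<omega>. ennreal ((\<sigma> * sqrt (V t \<omega>)) ^ (2 * m)) \<partial>M) \<le> ennreal Ks"
    using diffusion_moment[OF m] by blast
  define C where "C = 4 ^ m * (mart_const m * Ks + T ^ m * Kb)"
  have "(\<integral>\<^sup>+ \<omega>. ennreal ((V t \<omega> - V0) ^ (2 * m)) \<partial>M) \<le> ennreal (C * t ^ m)" if t: "t \<in> {0<..T}" for t
  proof -
    have "(\<integral>\<^sup>+ \<omega>. ennreal ((V t \<omega> - V0) ^ (2 * m)) \<partial>M) = (\<integral>\<^sup>+ \<omega>. ennreal ((V t \<omega> - V 0 \<omega>) ^ (2 * m)) \<partial>M)"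
      by (intro nn_integral_cong) (simp add: V_init)
    also have "\<dots> \<le> ennreal (4 ^ m * (mart_const m * (t ^ m * Ks) + t ^ (2 * m) * Kb))"
      using t by (intro increment_moment m Kb Ks) auto
    also have "\<dots> \<le> ennreal (C * t ^ m)"
    proof (rule ennreal_leI)
      have "t ^ (2 * m) = t ^ m * t ^ m" by (simp add: mult_2 power_add)
      also have "\<dots> \<le> T ^ m * t ^ m" using t by (intro mult_right_mono power_mono) auto
      finally have "t ^ (2 * m) * Kb \<le> T ^ m * t ^ m * Kb" using Kb(1) by (rule mult_right_mono)
      then have "4 ^ m * (mart_const m * (t ^ m * Ks) + t ^ (2 * m) * Kb) \<le> 4 ^ m * (mart_const m * (t ^ m * Ks) + T ^ m * t ^ m * Kb)"
        by simp
      then show "4 ^ m * (mart_const m * (t ^ m * Ks) + t ^ (2 * m) * Kb) \<le> C * t ^ m"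
        by (simp add: C_def algebra_simps)
    qed
    finally show ?thesis .
  qed
  moreover have "C \<ge> 0" using Kb(1) Ks(1) T_pos mart_const_pos[of m] by (simp add: C_def)
  ultimately show ?thesis by blast
qed

end

subsection \<open>Negative moments of the integrated variance\<close>

context cir
begin

text \<open>By continuity V stays above V0 / 2 on some interval after time 0, whose length depends
  on the path; so there is a least dyadic level of this kind.\<close>

lemma ex_dyadic_integral_V_ge:
  assumes \<omega>: "\<omega> \<in> space M"
  shows "\<exists>j. T / 2 ^ j * V0 / 2 \<le> integral {0..T / 2 ^ j} (\<lambda>u. V u \<omega>)"
proof -
  have "continuous_on {0..T} (\<lambda>u. V u \<omega>)" by (rule X_cont[OF \<omega>])
  then obtain d where d: "d > 0" "\<And>v. v \<in> {0..T} \<Longrightarrow> dist v 0 < d \<Longrightarrow> dist (V v \<omega>) (V 0 \<omega>) < V0 / 2"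
    unfolding continuous_on_iff using T_pos params
    by (elim ballE[where x = 0] allE[where x = "V0 / 2"]) auto
  have "(\<lambda>j. T * (1 / 2) ^ j) \<longlonglongrightarrow> T * 0"
    by (intro tendsto_mult tendsto_const LIMSEQ_power_zero) simp
  then have "eventually (\<lambda>j. T * (1 / 2) ^ j < d) sequentially"
    using d(1) by (intro order_tendstoD) simp_all
  then obtain j where j: "T / 2 ^ j < d"
    by (auto simp: eventually_sequentially power_divide)
  have le: "0 < T / 2 ^ j" "T / 2 ^ j \<le> T"
    using T_pos by (auto simp: divide_le_eq)
  have "integral {0..T / 2 ^ j} (\<lambda>u. V0 / 2) \<le> integral {0..T / 2 ^ j} (\<lambda>u. V u \<omega>)"
  proof (rule integral_le)
    show "(\<lambda>u. V u \<omega>) integrable_on {0..T / 2 ^ j}"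
      using le by (intro integrable_continuous_real continuous_on_subset[OF X_cont[OF \<omega>]]) auto
    fix u assume u: "u \<in> {0..T / 2 ^ j}"
    then have "dist (V u \<omega>) (V 0 \<omega>) < V0 / 2"
      using le j by (intro d(2)) (auto simp: dist_real_def)
    then have "\<bar>V u \<omega> - V0\<bar> < V0 / 2" by (simp only: V_init[OF \<omega>] dist_real_def)
    then show "V0 / 2 \<le> V u \<omega>" by linarith
  qed auto
  then show ?thesis using le by (intro exI[of _ j]) simp
qed

lemma integral_V_mono:
  assumes \<omega>: "\<omega> \<in> space M"
  shows "integral {0..T / 2 ^ j} (\<lambda>u. V u \<omega>) \<le> integral {0..T} (\<lambda>u. V u \<omega>)"
proof (rule integral_subset_le)
  have "T / 2 ^ j \<le> T" using T_pos by (simp add: divide_le_eq)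
  then show sub: "{0..T / 2 ^ j} \<subseteq> {0..T}" by auto
  show "(\<lambda>u. V u \<omega>) integrable_on {0..T / 2 ^ j}" "(\<lambda>u. V u \<omega>) integrable_on {0..T}"
    using sub by (intro integrable_continuous_real continuous_on_subset[OF X_cont[OF \<omega>]]; auto)+
qed (use V_nonneg \<omega> in auto)

lemma integral_V_gt_0:
  assumes \<omega>: "\<omega> \<in> space M"
  shows "integral {0..T} (\<lambda>u. V u \<omega>) > 0"
proof -
  obtain j where "T / 2 ^ j * V0 / 2 \<le> integral {0..T / 2 ^ j} (\<lambda>u. V u \<omega>)"
    using ex_dyadic_integral_V_ge[OF \<omega>] by blast
  moreover have "0 < T / 2 ^ j * V0 / 2" using T_pos params by simp
  ultimately show ?thesis using integral_V_mono[OF \<omega>, of j] by linarith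
qed

text \<open>Deviation of the average of V over [0, T / 2^j] from V0, in units of V0 / 2; an average
  below V0 / 2 means a value below -1.\<close>

definition dev :: "nat \<Rightarrow> 'a \<Rightarrow> real" where
  "dev j \<omega> = 2 * 2 ^ j / (T * V0) * integral {0..T / 2 ^ j} (\<lambda>u. V u \<omega> - V0)"

lemma dev_measurable: "dev j \<in> borel_measurable M"
proof -
  have "T / 2 ^ j \<le> T" using T_pos by (simp add: divide_le_eq)
  then show ?thesis
    unfolding dev_def[abs_def] using T_pos
    by (intro borel_measurable_times borel_measurable_const borel_measurable_integral_path
        borel_measurable_diff X_measurable continuous_on_diff continuous_on_const continuous_on_subset[OF X_cont]) auto
qed

text \<open>The prefactor of \<open>dev\<close> cancels the length \<open>e = T / 2 ^ j\<close> of
  the interval up to 2 / V0, which leaves the order \<open>e ^ m\<close> of the increments of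
  V.\<close>

lemma dev_moment:
  assumes m: "m > 0"
  shows "\<exists>C\<ge>0. \<forall>j. (\<integral>\<^sup>+ \<omega>. ennreal (dev j \<omega> ^ (2 * m)) \<partial>M) \<le> ennreal (C * (1 / 2 ^ j) ^ m)"
proof -
  obtain C where C: "C \<ge> 0" "\<And>t. t \<in> {0<..T} \<Longrightarrow> (\<integral>\<^sup>+ \<omega>. ennreal ((V t \<omega> - V0) ^ (2 * m)) \<partial>M) \<le> ennreal (C * t ^ m)"
    using V_increment_moment[OF m] by blast
  define C' where "C' = (2 / V0) ^ (2 * m) * (C * T ^ m)"
  have "(\<integral>\<^sup>+ \<omega>. ennreal (dev j \<omega> ^ (2 * m)) \<partial>M) \<le> ennreal (C' * (1 / 2 ^ j) ^ m)" for j
  proof -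
    define e where "e = T / 2 ^ j"
    have e: "0 < e" "e \<le> T" using T_pos by (auto simp: e_def divide_le_eq)
    have meas: "(\<lambda>\<omega>. V u \<omega> - V0) \<in> borel_measurable M" if "u \<in> {0..e}" for u
      using that e by (intro borel_measurable_diff X_measurable borel_measurable_const) auto
    have cont: "continuous_on {0..e} (\<lambda>u. V u \<omega> - V0)" if "\<omega> \<in> space M" for \<omega>
      using that e by (intro continuous_on_diff continuous_on_const continuous_on_subset[OF X_cont]) auto
    have "(\<integral>\<^sup>+ \<omega>. ennreal (integral {0..e} (\<lambda>u. V u \<omega> - V0) ^ (2 * m)) \<partial>M) \<le> ennreal (e ^ (2 * m) * (C * e ^ m))"
    proof (rule nn_moment_time_integral[OF meas cont])
      fix u assume u: "u \<in> {0..e}"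
      show "(\<integral>\<^sup>+ \<omega>. ennreal ((V u \<omega> - V0) ^ (2 * m)) \<partial>M) \<le> ennreal (C * e ^ m)"
      proof (cases "u = 0")
        case True
        have "(\<integral>\<^sup>+ \<omega>. ennreal ((V u \<omega> - V0) ^ (2 * m)) \<partial>M) = (\<integral>\<^sup>+ \<omega>. 0 \<partial>M)"
          using m by (intro nn_integral_cong) (simp add: True V_init zero_power)
        then show ?thesis by simp
      next
        case False
        then have "(\<integral>\<^sup>+ \<omega>. ennreal ((V u \<omega> - V0) ^ (2 * m)) \<partial>M) \<le> ennreal (C * u ^ m)"
          using u e by (intro C) auto
        also have "\<dots> \<le> ennreal (C * e ^ m)"
          using u C(1) by (intro ennreal_leI mult_left_mono power_mono) auto
        finally show ?thesis .
      qed
    qed (use e C m in auto)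
    then have "(\<integral>\<^sup>+ \<omega>. ennreal (dev j \<omega> ^ (2 * m)) \<partial>M)
        \<le> ennreal ((2 * 2 ^ j / (T * V0)) ^ (2 * m) * (e ^ (2 * m) * (C * e ^ m)))"
      unfolding dev_def e_def[symmetric]
      using e C by (intro nn_moment_cmult borel_measurable_integral_path[OF meas cont]) auto
    also have "(2 * 2 ^ j / (T * V0)) ^ (2 * m) * (e ^ (2 * m) * (C * e ^ m)) = C' * (1 / 2 ^ j) ^ m"
    proof -
      have "2 * 2 ^ j / (T * V0) * e = 2 / V0" using T_pos by (simp add: e_def)
      then have "(2 * 2 ^ j / (T * V0)) ^ (2 * m) * e ^ (2 * m) = (2 / V0) ^ (2 * m)"
        by (simp only: power_mult_distrib[symmetric])
      moreover have "e ^ m = T ^ m * (1 / 2 ^ j) ^ m"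
        by (simp add: e_def power_divide)
      ultimately show ?thesis unfolding C'_def by (simp only: mult.assoc[symmetric])
    qed
    finally show ?thesis .
  qed
  moreover have "C' \<ge> 0" using C(1) T_pos by (simp add: C'_def)
  ultimately show ?thesis by blast
qed

text \<open>Let \<open>j\<close> be the first dyadic level at which the average of \<open>V\<close> over \<open>[0, T / 2\<^sup>j]\<close> is at least \<open>V0 / 2\<close>.
  Then \<open>\<integral> V\<close> is at least of order \<open>2\<^sup>-\<^sup>j\<close>, and if \<open>j > 0\<close> the normalised deviation at level \<open>j - 1\<close> is at least 1.\<close>
lemma inverse_integral_le:
  assumes \<omega>: "\<omega> \<in> space M"
  shows "ennreal ((1 / integral {0..T} (\<lambda>u. V u \<omega>)) ^ p)
    \<le> ennreal ((2 / (T * V0)) ^ p) * (1 + (\<Sum>j. ennreal ((2 ^ Suc j) ^ p * dev j \<omega> ^ (2 * m))))"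
proof -
  define I where "I = (\<lambda>j. integral {0..T / 2 ^ j} (\<lambda>u. V u \<omega>))"
  define j where "j = (LEAST j. T / 2 ^ j * V0 / 2 \<le> I j)"
  have j: "T / 2 ^ j * V0 / 2 \<le> I j"
    unfolding j_def by (rule LeastI_ex) (unfold I_def, rule ex_dyadic_integral_V_ge[OF \<omega>])
  have ineq: "1 / integral {0..T} (\<lambda>u. V u \<omega>) \<le> 2 / (T * V0) * 2 ^ j"
  proof -
    have "0 < T / 2 ^ j * V0 / 2" using T_pos params by simp
    moreover have "T / 2 ^ j * V0 / 2 \<le> integral {0..T} (\<lambda>u. V u \<omega>)"
      using j integral_V_mono[OF \<omega>, of j] by (simp add: I_def)
    ultimately have "1 / integral {0..T} (\<lambda>u. V u \<omega>) \<le> 1 / (T / 2 ^ j * V0 / 2)"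
      by (intro frac_le) auto
    then show ?thesis by (simp add: mult.commute)
  qed
  have "(1 / integral {0..T} (\<lambda>u. V u \<omega>)) ^ p \<le> (2 / (T * V0) * 2 ^ j) ^ p"
    using ineq integral_V_gt_0[OF \<omega>] by (intro power_mono) auto
  also have "\<dots> = (2 / (T * V0)) ^ p * (2 ^ j) ^ p"
    by (rule power_mult_distrib)
  finally have "ennreal ((1 / integral {0..T} (\<lambda>u. V u \<omega>)) ^ p) \<le> ennreal ((2 / (T * V0)) ^ p * (2 ^ j) ^ p)"
    by (rule ennreal_leI)
  also have "\<dots> = ennreal ((2 / (T * V0)) ^ p) * ennreal ((2 ^ j) ^ p)"
    using T_pos params by (intro ennreal_mult) auto
  also have "\<dots> \<le> ennreal ((2 / (T * V0)) ^ p) * (1 + (\<Sum>j. ennreal ((2 ^ Suc j) ^ p * dev j \<omega> ^ (2 * m))))"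
  proof (rule mult_left_mono)
    show "ennreal ((2 ^ j) ^ p) \<le> 1 + (\<Sum>j. ennreal ((2 ^ Suc j) ^ p * dev j \<omega> ^ (2 * m)))"
    proof (cases j)
      case 0
      then show ?thesis by (simp add: add_increasing2)
    next
      case (Suc i)
      then have "\<not> T / 2 ^ i * V0 / 2 \<le> I i"
        unfolding j_def by (intro not_less_Least) simp
      then have lt: "I i < T / 2 ^ i * V0 / 2" by simp
      have le: "0 < T / 2 ^ i" "T / 2 ^ i \<le> T" using T_pos by (auto simp: divide_le_eq)
      have "integral {0..T / 2 ^ i} (\<lambda>u. V u \<omega> - V0) = I i - T / 2 ^ i * V0"
        using le integrable_continuous_real[OF continuous_on_subset[OF X_cont[OF \<omega>], of "{0..T / 2 ^ i}"]]
        unfolding I_def by (subst integral_diff) auto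
      also have "\<dots> \<le> - (T / 2 ^ i * V0 / 2)" using lt by simp
      finally have "dev i \<omega> \<le> 2 * 2 ^ i / (T * V0) * - (T / 2 ^ i * V0 / 2)"
        unfolding dev_def using T_pos params by (intro mult_left_mono) auto
      also have "\<dots> = - 1" using T_pos params by simp
      finally have "1 \<le> \<bar>dev i \<omega>\<bar>" by simp
      then have "1 \<le> \<bar>dev i \<omega>\<bar> ^ (2 * m)" by (rule one_le_power)
      then have "1 \<le> dev i \<omega> ^ (2 * m)" by (simp add: power_even_abs)
      \<comment> \<open>The weight belongs to level \<open>Suc i\<close> and the deviation to level
        i; hence the shift in the series.\<close>
      then have "(2 ^ Suc i) ^ p * 1 \<le> (2 ^ Suc i) ^ p * dev i \<omega> ^ (2 * m)"
        by (intro mult_left_mono) auto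
      then have "ennreal ((2 ^ j) ^ p) \<le> ennreal ((2 ^ Suc i) ^ p * dev i \<omega> ^ (2 * m))"
        unfolding Suc by (intro ennreal_leI) simp
      \<comment> \<open>The level i depends on \<omega>; the sum over all levels is a bound that can
        be integrated term by term.\<close>
      also have "\<dots> \<le> (\<Sum>j. ennreal ((2 ^ Suc j) ^ p * dev j \<omega> ^ (2 * m)))"
      proof -
        have "g i \<le> suminf g" for g :: "nat \<Rightarrow> ennreal"
          using sum_le_suminf[of g "{i}"] by (simp add: summableI)
        then show ?thesis .
      qed
      finally show ?thesis by (rule add_increasing[rotated]) simp
    qed
  qed simp
  finally show ?thesis .
qed

lemma inverse_integral_moment:
  "\<exists>K\<ge>0. (\<integral>\<^sup>+ \<omega>. ennreal ((1 / integral {0..T} (\<lambda>u. V u \<omega>)) ^ p) \<partial>M) \<le> ennreal K"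
proof -
  \<comment> \<open>With \<open>m = p + 1\<close> the growth \<open>2 ^ (j * p)\<close> meets the
    decay \<open>(1 / 2 ^ j) ^ m\<close> and leaves a geometric series of ratio 1/2.\<close>
  define m where "m = Suc p"
  obtain C where C: "C \<ge> 0" "\<And>j. (\<integral>\<^sup>+ \<omega>. ennreal (dev j \<omega> ^ (2 * m)) \<partial>M) \<le> ennreal (C * (1 / 2 ^ j) ^ m)"
    using dev_moment[of m] by (auto simp: m_def)
  let ?c = "(2 / (T * V0)) ^ p"
  have c: "?c \<ge> 0" using T_pos params by simp
  have [measurable]: "dev j \<in> borel_measurable M" for j by (rule dev_measurable)
  have term_le: "(\<integral>\<^sup>+ \<omega>. ennreal ((2 ^ Suc j) ^ p * dev j \<omega> ^ (2 * m)) \<partial>M) \<le> ennreal (2 ^ p * C * (1 / 2) ^ j)" for j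
  proof -
    have "(\<integral>\<^sup>+ \<omega>. ennreal ((2 ^ Suc j) ^ p * dev j \<omega> ^ (2 * m)) \<partial>M)
        = ennreal ((2 ^ Suc j) ^ p) * (\<integral>\<^sup>+ \<omega>. ennreal (dev j \<omega> ^ (2 * m)) \<partial>M)"
      by (subst nn_integral_cmult[symmetric]) (auto simp: ennreal_mult)
    also have "\<dots> \<le> ennreal ((2 ^ Suc j) ^ p) * ennreal (C * (1 / 2 ^ j) ^ m)"
      by (intro mult_left_mono C) simp
    also have "\<dots> = ennreal ((2 ^ Suc j) ^ p * (C * (1 / 2 ^ j) ^ m))"
      using C by (intro ennreal_mult[symmetric]) auto
    also have "(2 ^ Suc j) ^ p * (C * (1 / 2 ^ j) ^ m) = 2 ^ p * C * (1 / 2) ^ j"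
      by (simp add: m_def power_mult_distrib power_divide)
    finally show ?thesis .
  qed
  have "(\<integral>\<^sup>+ \<omega>. ennreal ((1 / integral {0..T} (\<lambda>u. V u \<omega>)) ^ p) \<partial>M)
      \<le> (\<integral>\<^sup>+ \<omega>. ennreal ?c * (1 + (\<Sum>j. ennreal ((2 ^ Suc j) ^ p * dev j \<omega> ^ (2 * m)))) \<partial>M)"
    by (intro nn_integral_mono inverse_integral_le)
  also have "\<dots> = ennreal ?c * (1 + (\<Sum>j. \<integral>\<^sup>+ \<omega>. ennreal ((2 ^ Suc j) ^ p * dev j \<omega> ^ (2 * m)) \<partial>M))"
    by (simp add: nn_integral_cmult nn_integral_add nn_integral_suminf emeasure_space_1)
  also have "\<dots> \<le> ennreal ?c * (1 + (\<Sum>j. ennreal (2 ^ p * C * (1 / 2) ^ j)))"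
    by (intro mult_left_mono add_left_mono suminf_le term_le summableI) simp
  also have "(\<Sum>j. ennreal (2 ^ p * C * (1 / 2) ^ j)) = ennreal (\<Sum>j. 2 ^ p * C * (1 / 2) ^ j)"
    using C(1) by (intro suminf_ennreal2 summable_mult summable_geometric) auto
  also have "ennreal ?c * (1 + ennreal (\<Sum>j. 2 ^ p * C * (1 / 2) ^ j)) = ennreal (?c * (1 + (\<Sum>j. 2 ^ p * C * (1 / 2) ^ j)))"
  proof -
    have "0 \<le> (\<Sum>j. 2 ^ p * C * (1 / 2) ^ j)"
      using C(1) by (intro suminf_nonneg summable_mult summable_geometric) auto
    then show ?thesis using c by (simp add: ennreal_mult)
  qed
  finally have *: "(\<integral>\<^sup>+ \<omega>. ennreal ((1 / integral {0..T} (\<lambda>u. V u \<omega>)) ^ p) \<partial>M)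
      \<le> ennreal (?c * (1 + (\<Sum>j. 2 ^ p * C * (1 / 2) ^ j)))" .
  have "0 \<le> (\<Sum>j. 2 ^ p * C * (1 / 2) ^ j)"
    using C(1) by (intro suminf_nonneg summable_mult summable_geometric) auto
  then show ?thesis using * c by (intro exI[of _ "?c * (1 + (\<Sum>j. 2 ^ p * C * (1 / 2) ^ j))"]) auto
qed

end

subsection \<open>Strong convergence of order one\<close>

lemma abs_powr_even:
  fixes x :: real
  assumes "m > 0"
  shows "\<bar>x\<bar> powr real (2 * m) = x ^ (2 * m)"
proof (cases "x = 0")
  case False
  then have "\<bar>x\<bar> powr real (2 * m) = \<bar>x\<bar> ^ (2 * m)" by (subst powr_realpow) auto
  then show ?thesis by (simp add: power_even_abs)
qed (use assms in \<open>simp add: zero_power\<close>)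

text \<open>Multiplication by \<open>sqrt a + sqrt b\<close>, which is at least
  \<open>sqrt a\<close>, gives \<open>a - b\<close>. Only a stands in the denominator, so b, a
  Riemann sum that may be small, needs no negative moments.\<close>

lemma sqrt_diff_power_le:
  fixes a b :: real
  assumes a: "a > 0" and b: "b \<ge> 0"
  shows "(sqrt a - sqrt b) ^ (2 * m) \<le> (a - b) ^ (2 * m) * (1 / a) ^ m"
proof -
  have "sqrt a * \<bar>sqrt a - sqrt b\<bar> \<le> (sqrt a + sqrt b) * \<bar>sqrt a - sqrt b\<bar>"
    using b by (intro mult_right_mono) auto
  also have "\<dots> = \<bar>(sqrt a + sqrt b) * (sqrt a - sqrt b)\<bar>"
    using a b by (simp add: abs_mult)
  also have "(sqrt a + sqrt b) * (sqrt a - sqrt b) = a - b"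
    using a b by (simp add: algebra_simps)
  finally have "(sqrt a * \<bar>sqrt a - sqrt b\<bar>) ^ (2 * m) \<le> \<bar>a - b\<bar> ^ (2 * m)"
    using a by (intro power_mono) auto
  then have "a ^ m * (sqrt a - sqrt b) ^ (2 * m) \<le> (a - b) ^ (2 * m)"
    using a by (simp add: power_mult_distrib power_mult[of "sqrt _"] power_even_abs)
  then show ?thesis using a by (simp add: power_divide field_simps)
qed

lemma mult3_le_cubes:
  fixes x y z :: real
  assumes "x \<ge> 0" "y \<ge> 0" "z \<ge> 0"
  shows "x * y * z \<le> x ^ 3 + y ^ 3 + z ^ 3"
proof -
  define w where "w = max x (max y z)"
  have "x * y * z \<le> w * w * w"
    using assms by (intro mult_mono) (auto simp: w_def)
  also have "\<dots> = w ^ 3" by (simp add: power3_eq_cube)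
  also have "\<dots> \<le> x ^ 3 + y ^ 3 + z ^ 3"
    using assms by (auto simp: w_def max_def)
  finally show ?thesis .
qed

lemma nn_integral_SUP_bound:
  fixes f :: "'i \<Rightarrow> ennreal"
  assumes "(SUP t\<in>I. f t) < \<infinity>"
  shows "\<exists>K\<ge>0. \<forall>t\<in>I. f t \<le> ennreal K"
proof -
  obtain K where "K \<ge> 0" "(SUP t\<in>I. f t) = ennreal K"
    using assms by (cases "SUP t\<in>I. f t") auto
  then show ?thesis by (metis SUP_upper)
qed

text \<open>All even moments are demanded at once because the estimate of a product at exponent 2m
  uses one factor at exponent 6m. The constant may depend on m but not on n.\<close>

definition strong_order_one :: "'a measure \<Rightarrow> real \<Rightarrow> (nat \<Rightarrow> 'a \<Rightarrow> real) \<Rightarrow> bool" where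
  "strong_order_one M T Z \<longleftrightarrow> (\<forall>n. Z n \<in> borel_measurable M) \<and>
    (\<forall>m>0. \<exists>C\<ge>0. \<forall>n>0. (\<integral>\<^sup>+ \<omega>. ennreal (Z n \<omega> ^ (2 * m)) \<partial>M) \<le> ennreal (C * (T / real n) ^ (2 * m)))"

lemma strong_order_one_measurable: "strong_order_one M T Z \<Longrightarrow> Z n \<in> borel_measurable M"
  by (simp add: strong_order_one_def)

lemma strong_order_oneI:
  assumes "\<And>n. Z n \<in> borel_measurable M"
    and "\<And>m. m > 0 \<Longrightarrow> \<exists>C\<ge>0. \<forall>n>0. (\<integral>\<^sup>+ \<omega>. ennreal (Z n \<omega> ^ (2 * m)) \<partial>M) \<le> ennreal (C * (T / real n) ^ (2 * m))"
  shows "strong_order_one M T Z"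
  using assms by (simp add: strong_order_one_def)

lemma strong_order_oneE:
  assumes "strong_order_one M T Z" "m > 0"
  obtains C where "C \<ge> 0" "\<And>n. n > 0 \<Longrightarrow> (\<integral>\<^sup>+ \<omega>. ennreal (Z n \<omega> ^ (2 * m)) \<partial>M) \<le> ennreal (C * (T / real n) ^ (2 * m))"
  using assms unfolding strong_order_one_def by meson

lemma strong_order_one_add:
  assumes Z: "strong_order_one M T Z" and Y: "strong_order_one M T Y"
  shows "strong_order_one M T (\<lambda>n \<omega>. Z n \<omega> + Y n \<omega>)"
proof (rule strong_order_oneI)
  note meas = strong_order_one_measurable[OF Z] strong_order_one_measurable[OF Y]
  show "(\<lambda>\<omega>. Z n \<omega> + Y n \<omega>) \<in> borel_measurable M" for n
    using meas by simp
  fix m :: nat assume m: "m > 0"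
  obtain C where C: "C \<ge> 0" "\<And>n. n > 0 \<Longrightarrow> (\<integral>\<^sup>+ \<omega>. ennreal (Z n \<omega> ^ (2 * m)) \<partial>M) \<le> ennreal (C * (T / real n) ^ (2 * m))"
    by (rule strong_order_oneE[OF Z m]) blast
  obtain D where D: "D \<ge> 0" "\<And>n. n > 0 \<Longrightarrow> (\<integral>\<^sup>+ \<omega>. ennreal (Y n \<omega> ^ (2 * m)) \<partial>M) \<le> ennreal (D * (T / real n) ^ (2 * m))"
    by (rule strong_order_oneE[OF Y m]) blast
  have "(\<integral>\<^sup>+ \<omega>. ennreal ((Z n \<omega> + Y n \<omega>) ^ (2 * m)) \<partial>M) \<le> ennreal (4 ^ m * (C + D) * (T / real n) ^ (2 * m))"
    if "n > 0" for n
  proof -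
    have "0 \<le> C * (T / real n) ^ (2 * m)" "0 \<le> D * (T / real n) ^ (2 * m)"
      using C(1) D(1) by (auto intro!: mult_nonneg_nonneg)
    then show ?thesis
      using nn_moment_add[OF meas C(2)[OF that] _ D(2)[OF that]] by (simp only: distrib_right mult.assoc)
  qed
  then show "\<exists>C\<ge>0. \<forall>n>0. (\<integral>\<^sup>+ \<omega>. ennreal ((Z n \<omega> + Y n \<omega>) ^ (2 * m)) \<partial>M) \<le> ennreal (C * (T / real n) ^ (2 * m))"
    using C(1) D(1) by (intro exI[of _ "4 ^ m * (C + D)"]) auto
qed

lemma strong_order_one_cmult:
  assumes Z: "strong_order_one M T Z"
  shows "strong_order_one M T (\<lambda>n \<omega>. c * Z n \<omega>)"
proof (rule strong_order_oneI)
  note meas = strong_order_one_measurable[OF Z]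
  show "(\<lambda>\<omega>. c * Z n \<omega>) \<in> borel_measurable M" for n
    using meas by simp
  fix m :: nat assume m: "m > 0"
  obtain C where C: "C \<ge> 0" "\<And>n. n > 0 \<Longrightarrow> (\<integral>\<^sup>+ \<omega>. ennreal (Z n \<omega> ^ (2 * m)) \<partial>M) \<le> ennreal (C * (T / real n) ^ (2 * m))"
    by (rule strong_order_oneE[OF Z m]) blast
  have "(\<integral>\<^sup>+ \<omega>. ennreal ((c * Z n \<omega>) ^ (2 * m)) \<partial>M) \<le> ennreal (c ^ (2 * m) * C * (T / real n) ^ (2 * m))"
    if "n > 0" for n
    using nn_moment_cmult[OF meas C(2)[OF that], of c] C(1) by (simp add: mult.assoc)
  then show "\<exists>C\<ge>0. \<forall>n>0. (\<integral>\<^sup>+ \<omega>. ennreal ((c * Z n \<omega>) ^ (2 * m)) \<partial>M) \<le> ennreal (C * (T / real n) ^ (2 * m))"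
    using C(1) by (intro exI[of _ "c ^ (2 * m) * C"]) auto
qed

text \<open>The interpolation \<open>y powr q \<le> 1 + y ^ (2 * m)\<close> is applied to |Z| / h;
  applied to |Z| itself, the summand 1 would destroy the order in h.\<close>

lemma (in prob_space) strong_order_one_powr:
  assumes Z: "strong_order_one M T Z" and T: "T > 0" and q: "q > 0"
  shows "\<exists>C. \<forall>n>0. (\<integral>\<^sup>+ \<omega>. ennreal (\<bar>Z n \<omega>\<bar> powr q) \<partial>M) \<le> ennreal (C * (T / real n) powr q)"
proof -
  define m where "m = nat \<lceil>q\<rceil>"
  have m: "m > 0" "q \<le> real (2 * m)" using q by (auto simp: m_def) linarith
  obtain C where C: "C \<ge> 0" "\<And>n. n > 0 \<Longrightarrow> (\<integral>\<^sup>+ \<omega>. ennreal (Z n \<omega> ^ (2 * m)) \<partial>M) \<le> ennreal (C * (T / real n) ^ (2 * m))"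
    by (rule strong_order_oneE[OF Z m(1)]) blast
  have "(\<integral>\<^sup>+ \<omega>. ennreal (\<bar>Z n \<omega>\<bar> powr q) \<partial>M) \<le> ennreal ((1 + C) * (T / real n) powr q)" if n: "n > 0" for n
  proof -
    define h where "h = T / real n"
    have h: "h > 0" using T n by (simp add: h_def)
    have [measurable]: "Z n \<in> borel_measurable M" using Z by (rule strong_order_one_measurable)
    have pt: "ennreal (\<bar>Z n \<omega>\<bar> powr q) \<le> ennreal (h powr q) * (1 + ennreal ((1 / h) ^ (2 * m)) * ennreal (Z n \<omega> ^ (2 * m)))" for \<omega>
    proof -
      define y where "y = \<bar>Z n \<omega>\<bar> / h"
      have y: "y \<ge> 0" using h by (simp add: y_def)
      have "y powr q \<le> 1 + y ^ (2 * m)"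
      proof (cases "y \<le> 1")
        case True
        then have "y powr q \<le> 1" using q y by (intro powr_le1) auto
        then show ?thesis by (simp add: add_increasing2)
      next
        case False
        then have "y powr q \<le> y powr real (2 * m)" using m by (intro powr_mono) auto
        also have "\<dots> = y ^ (2 * m)" using False by (subst powr_realpow) auto
        finally show ?thesis by simp
      qed
      moreover have "\<bar>Z n \<omega>\<bar> powr q = h powr q * y powr q"
        using h y by (subst powr_mult[symmetric]) (auto simp: y_def)
      moreover have "y ^ (2 * m) = (1 / h) ^ (2 * m) * Z n \<omega> ^ (2 * m)"
        by (simp add: y_def power_divide power_even_abs)
      ultimately have "\<bar>Z n \<omega>\<bar> powr q \<le> h powr q * (1 + (1 / h) ^ (2 * m) * Z n \<omega> ^ (2 * m))"
        by (simp add: mult_left_mono)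
      then have "ennreal (\<bar>Z n \<omega>\<bar> powr q) \<le> ennreal (h powr q * (1 + (1 / h) ^ (2 * m) * Z n \<omega> ^ (2 * m)))"
        by (rule ennreal_leI)
      also have "\<dots> = ennreal (h powr q) * (1 + ennreal ((1 / h) ^ (2 * m)) * ennreal (Z n \<omega> ^ (2 * m)))"
        by (subst ennreal_mult, simp, simp) (subst ennreal_plus, auto simp: ennreal_mult)
      finally show ?thesis .
    qed
    have "(\<integral>\<^sup>+ \<omega>. ennreal (\<bar>Z n \<omega>\<bar> powr q) \<partial>M)
        \<le> (\<integral>\<^sup>+ \<omega>. ennreal (h powr q) * (1 + ennreal ((1 / h) ^ (2 * m)) * ennreal (Z n \<omega> ^ (2 * m))) \<partial>M)"
      by (intro nn_integral_mono pt)
    also have "\<dots> = ennreal (h powr q) * (1 + ennreal ((1 / h) ^ (2 * m)) * (\<integral>\<^sup>+ \<omega>. ennreal (Z n \<omega> ^ (2 * m)) \<partial>M))"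
      by (simp add: nn_integral_cmult nn_integral_add emeasure_space_1)
    also have "\<dots> \<le> ennreal (h powr q) * (1 + ennreal ((1 / h) ^ (2 * m)) * ennreal (C * h ^ (2 * m)))"
      using C(2)[OF n] by (intro mult_left_mono add_left_mono) (auto simp: h_def)
    also have "ennreal ((1 / h) ^ (2 * m)) * ennreal (C * h ^ (2 * m)) = ennreal C"
      using C(1) h by (subst ennreal_mult[symmetric]) (auto simp: power_divide)
    also have "ennreal (h powr q) * (1 + ennreal C) = ennreal ((1 + C) * h powr q)"
      using C(1) by (simp add: ennreal_mult mult.commute)
    finally show ?thesis by (simp add: h_def)
  qed
  then show ?thesis by blast
qed

section \<open>Order one for each source of error\<close>

context sde
begin

lemma path_integral_measurable: "(\<lambda>\<omega>. integral {0..T} (\<lambda>u. X u \<omega>)) \<in> borel_measurable M"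
  using T_pos by (intro borel_measurable_integral_path X_measurable X_cont) auto

lemma left_sum_measurable: "(\<lambda>\<omega>. \<Sum>i<n. X (real i * (T / real n)) \<omega> * (T / real n)) \<in> borel_measurable M"
  using grid_mem[of T _ n] T_pos by (intro borel_measurable_sum borel_measurable_times X_measurable) auto

lemma quadrature_order_one:
  assumes b: "\<And>m. m > 0 \<Longrightarrow> \<exists>K\<ge>0. \<forall>t\<in>{0..T}. (\<integral>\<^sup>+ \<omega>. ennreal (b t (X t \<omega>) ^ (2 * m)) \<partial>M) \<le> ennreal K"
    and s: "\<And>m. m > 0 \<Longrightarrow> \<exists>K\<ge>0. \<forall>t\<in>{0..T}. (\<integral>\<^sup>+ \<omega>. ennreal (s t (X t \<omega>) ^ (2 * m)) \<partial>M) \<le> ennreal K"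
  shows "strong_order_one M T (\<lambda>n \<omega>. integral {0..T} (\<lambda>u. X u \<omega>) - (\<Sum>i<n. X (real i * (T / real n)) \<omega> * (T / real n)))"
proof (rule strong_order_oneI)
  show "(\<lambda>\<omega>. integral {0..T} (\<lambda>u. X u \<omega>) - (\<Sum>i<n. X (real i * (T / real n)) \<omega> * (T / real n))) \<in> borel_measurable M" for n
    by (intro borel_measurable_diff path_integral_measurable left_sum_measurable)
  fix m :: nat assume m: "m > 0"
  obtain Kb where Kb: "Kb \<ge> 0" "\<And>t. t \<in> {0..T} \<Longrightarrow> (\<integral>\<^sup>+ \<omega>. ennreal (b t (X t \<omega>) ^ (2 * m)) \<partial>M) \<le> ennreal Kb"
    using b[OF m] by blast
  obtain Ks where Ks: "Ks \<ge> 0" "\<And>t. t \<in> {0..T} \<Longrightarrow> (\<integral>\<^sup>+ \<omega>. ennreal (s t (X t \<omega>) ^ (2 * m)) \<partial>M) \<le> ennreal Ks"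
    using s[OF m] by blast
  let ?C = "4 ^ m * (mart_const m * (T ^ m * Ks) + T ^ (2 * m) * Kb)"
  have "?C \<ge> 0" using Kb(1) Ks(1) T_pos mart_const_pos[of m] by simp
  then show "\<exists>C\<ge>0. \<forall>n>0. (\<integral>\<^sup>+ \<omega>. ennreal ((integral {0..T} (\<lambda>u. X u \<omega>) -
      (\<Sum>i<n. X (real i * (T / real n)) \<omega> * (T / real n))) ^ (2 * m)) \<partial>M) \<le> ennreal (C * (T / real n) ^ (2 * m))"
    using quadrature_moment[OF m Kb(1) Ks(1) _ Kb(2) Ks(2)] by (intro exI[of _ ?C]) auto
qed

end

context cir
begin

lemma variance_quadrature_order_one:
  "strong_order_one M T (\<lambda>n \<omega>. integral {0..T} (\<lambda>u. V u \<omega>) - (\<Sum>i<n. V (real i * (T / real n)) \<omega> * (T / real n)))"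
  by (rule quadrature_order_one[OF drift_moment diffusion_moment])

text \<open>The bound \<open>x y z \<le> x\<^sup>3 + y\<^sup>3 + z\<^sup>3\<close> separates the quadrature error, the negative power of the
  integrated variance and \<open>N\<close>.\<close>
lemma volatility_order_one:
  assumes N: "distributed M lborel N std_normal_density"
  shows "strong_order_one M T (\<lambda>n \<omega>. (sqrt (integral {0..T} (\<lambda>u. V u \<omega>))
    - sqrt (\<Sum>i<n. V (real i * (T / real n)) \<omega> * (T / real n))) * N \<omega>)"
proof (rule strong_order_oneI)
  define a where "a = (\<lambda>\<omega>. integral {0..T} (\<lambda>u. V u \<omega>))"
  define A where "A = (\<lambda>n \<omega>. \<Sum>i<n. V (real i * (T / real n)) \<omega> * (T / real n))"
  have a_meas [measurable]: "a \<in> borel_measurable M" unfolding a_def by (rule path_integral_measurable)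
  have A_meas [measurable]: "A n \<in> borel_measurable M" for n unfolding A_def by (rule left_sum_measurable)
  have N_meas [measurable]: "N \<in> borel_measurable M" using distributed_measurable[OF N] by simp
  have order: "strong_order_one M T (\<lambda>n \<omega>. a \<omega> - A n \<omega>)"
    using variance_quadrature_order_one by (simp add: a_def A_def)
  show "(\<lambda>\<omega>. (sqrt (integral {0..T} (\<lambda>u. V u \<omega>)) - sqrt (\<Sum>i<n. V (real i * (T / real n)) \<omega> * (T / real n))) * N \<omega>)
      \<in> borel_measurable M" for n
  proof -
    have "(\<lambda>\<omega>. (sqrt (a \<omega>) - sqrt (A n \<omega>)) * N \<omega>) \<in> borel_measurable M" by measurable
    then show ?thesis by (simp only: a_def A_def)
  qed
  fix m :: nat assume m: "m > 0"
  \<comment> \<open>Each of the three factors is cubed: exponent 6m for the quadrature error and for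
    N, exponent 3m for the inverse of a.\<close>
  then have m3: "3 * m > 0" by simp
  obtain C where C: "C \<ge> 0" "\<And>n. n > 0 \<Longrightarrow> (\<integral>\<^sup>+ \<omega>. ennreal ((a \<omega> - A n \<omega>) ^ (2 * (3 * m))) \<partial>M) \<le> ennreal (C * (T / real n) ^ (2 * (3 * m)))"
    by (rule strong_order_oneE[OF order m3]) blast
  obtain K where K: "K \<ge> 0" "(\<integral>\<^sup>+ \<omega>. ennreal ((1 / a \<omega>) ^ (3 * m)) \<partial>M) \<le> ennreal K"
    using inverse_integral_moment[of "3 * m"] unfolding a_def by blast
  obtain L where L: "L \<ge> 0" "(\<integral>\<^sup>+ \<omega>. ennreal (N \<omega> ^ (2 * (3 * m))) \<partial>M) \<le> ennreal L"
  proof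
    have "integrable M (\<lambda>\<omega>. N \<omega> ^ (2 * (3 * m)))"
      using distributed_integrable[OF N, of "\<lambda>x. x ^ (2 * (3 * m))"] integrable_std_normal_moment by simp
    then show "(\<integral>\<^sup>+ \<omega>. ennreal (N \<omega> ^ (2 * (3 * m))) \<partial>M) \<le> ennreal (expectation (\<lambda>\<omega>. N \<omega> ^ (2 * (3 * m))))"
      by (subst nn_integral_eq_integral) (auto intro!: AE_I2 zero_le_even_power)
  qed (auto intro!: integral_nonneg_AE AE_I2 zero_le_even_power)
  have "(\<integral>\<^sup>+ \<omega>. ennreal (((sqrt (a \<omega>) - sqrt (A n \<omega>)) * N \<omega>) ^ (2 * m)) \<partial>M) \<le> ennreal ((C + K + L) * (T / real n) ^ (2 * m))"
    if n: "n > 0" for n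
  proof -
    define h where "h = T / real n"
    have h: "h > 0" using n T_pos by (simp add: h_def)
    let ?x = "\<lambda>\<omega>. (a \<omega> - A n \<omega>) ^ (2 * (3 * m))" and ?y = "\<lambda>\<omega>. (1 / a \<omega>) ^ (3 * m)" and ?z = "\<lambda>\<omega>. N \<omega> ^ (2 * (3 * m))"
    have pt: "ennreal (((sqrt (a \<omega>) - sqrt (A n \<omega>)) * N \<omega>) ^ (2 * m))
        \<le> ennreal (h ^ (2 * m)) * (ennreal ((1 / h) ^ (2 * (3 * m))) * ennreal (?x \<omega>) + ennreal (?y \<omega>) + ennreal (?z \<omega>))"
      if \<omega>: "\<omega> \<in> space M" for \<omega>
    proof -
      have a: "a \<omega> > 0" unfolding a_def by (rule integral_V_gt_0[OF \<omega>])
      have A: "A n \<omega> \<ge> 0"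
        unfolding A_def using grid_mem[of T _ n] T_pos
        by (intro sum_nonneg mult_nonneg_nonneg V_nonneg[OF _ \<omega>]) auto
      have "((sqrt (a \<omega>) - sqrt (A n \<omega>)) * N \<omega>) ^ (2 * m) \<le> (a \<omega> - A n \<omega>) ^ (2 * m) * (1 / a \<omega>) ^ m * N \<omega> ^ (2 * m)"
        unfolding power_mult_distrib by (intro mult_right_mono sqrt_diff_power_le a A) auto
      \<comment> \<open>The error is divided by h before the cubes are formed; each of the three
        cubes then has a moment bounded in n.\<close>
      also have "\<dots> = h ^ (2 * m) * (((1 / h) ^ (2 * m) * (a \<omega> - A n \<omega>) ^ (2 * m)) * (1 / a \<omega>) ^ m * N \<omega> ^ (2 * m))"
        using h by (simp add: power_divide)
      also have "\<dots> \<le> h ^ (2 * m) * (((1 / h) ^ (2 * m) * (a \<omega> - A n \<omega>) ^ (2 * m)) ^ 3 + ((1 / a \<omega>) ^ m) ^ 3 + (N \<omega> ^ (2 * m)) ^ 3)"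
        using h a by (intro mult_left_mono mult3_le_cubes) auto
      also have "\<dots> = h ^ (2 * m) * ((1 / h) ^ (2 * (3 * m)) * ?x \<omega> + ?y \<omega> + ?z \<omega>)"
        by (simp add: power_mult_distrib power_mult[symmetric] mult.commute mult.left_commute)
      finally have "ennreal (((sqrt (a \<omega>) - sqrt (A n \<omega>)) * N \<omega>) ^ (2 * m))
          \<le> ennreal (h ^ (2 * m) * ((1 / h) ^ (2 * (3 * m)) * ?x \<omega> + ?y \<omega> + ?z \<omega>))"
        by (rule ennreal_leI)
      also have "\<dots> = ennreal (h ^ (2 * m)) * (ennreal ((1 / h) ^ (2 * (3 * m))) * ennreal (?x \<omega>) + ennreal (?y \<omega>) + ennreal (?z \<omega>))"
      proof -
        have nn: "0 \<le> h ^ (2 * m)" "0 \<le> (1 / h) ^ (2 * (3 * m))" "0 \<le> ?x \<omega>" "0 \<le> ?y \<omega>" "0 \<le> ?z \<omega>"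
          using h a by (auto simp: zero_le_even_power)
        show ?thesis
          using nn by (simp only: ennreal_mult ennreal_plus mult_nonneg_nonneg add_nonneg_nonneg)
      qed
      finally show ?thesis .
    qed
    have "(\<integral>\<^sup>+ \<omega>. ennreal (((sqrt (a \<omega>) - sqrt (A n \<omega>)) * N \<omega>) ^ (2 * m)) \<partial>M)
        \<le> (\<integral>\<^sup>+ \<omega>. ennreal (h ^ (2 * m)) * (ennreal ((1 / h) ^ (2 * (3 * m))) * ennreal (?x \<omega>) + ennreal (?y \<omega>) + ennreal (?z \<omega>)) \<partial>M)"
      by (intro nn_integral_mono pt)
    also have "\<dots> = ennreal (h ^ (2 * m)) * (ennreal ((1 / h) ^ (2 * (3 * m))) * (\<integral>\<^sup>+ \<omega>. ennreal (?x \<omega>) \<partial>M)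
        + (\<integral>\<^sup>+ \<omega>. ennreal (?y \<omega>) \<partial>M) + (\<integral>\<^sup>+ \<omega>. ennreal (?z \<omega>) \<partial>M))"
      by (subst nn_integral_cmult, measurable, subst nn_integral_add, measurable,
          subst nn_integral_add, measurable, subst nn_integral_cmult, measurable)
    also have "\<dots> \<le> ennreal (h ^ (2 * m)) * (ennreal ((1 / h) ^ (2 * (3 * m))) * ennreal (C * h ^ (2 * (3 * m))) + ennreal K + ennreal L)"
      using C(2)[OF n] K L unfolding h_def by (intro mult_left_mono add_mono) auto
    also have "ennreal ((1 / h) ^ (2 * (3 * m))) * ennreal (C * h ^ (2 * (3 * m))) = ennreal C"
      using C(1) h by (subst ennreal_mult[symmetric]) (auto simp: power_divide)
    also have "ennreal (h ^ (2 * m)) * (ennreal C + ennreal K + ennreal L) = ennreal ((C + K + L) * h ^ (2 * m))"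
      using C(1) K(1) L(1) h by (simp add: ennreal_mult mult.commute)
    finally show ?thesis by (simp only: h_def)
  qed
  then show "\<exists>C\<ge>0. \<forall>n>0. (\<integral>\<^sup>+ \<omega>. ennreal (((sqrt (integral {0..T} (\<lambda>u. V u \<omega>))
      - sqrt (\<Sum>i<n. V (real i * (T / real n)) \<omega> * (T / real n))) * N \<omega>) ^ (2 * m)) \<partial>M) \<le> ennreal (C * (T / real n) ^ (2 * m))"
    unfolding a_def A_def using C(1) K(1) L(1) by (intro exI[of _ "C + K + L"]) auto
qed

end

text \<open>T times an average of n errors, each of order h with a constant uniform in the grid
  point; the point \<open>i = 0\<close>, outside the range of \<open>rh_err\<close>, is exact by
  \<open>rh_init\<close>.\<close>

lemma (in sde) approximation_order_one:
  assumes rh_meas: "\<And>n i. rh n i \<in> borel_measurable M"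
    and rh_init: "\<And>n \<omega>. \<omega> \<in> space M \<Longrightarrow> rh n 0 \<omega> = X 0 \<omega>"
    and rh_err: "\<And>q. q \<ge> 1 \<Longrightarrow> \<exists>c. \<forall>n\<ge>1. \<forall>i\<in>{1..n}.
        (\<integral>\<^sup>+ \<omega>. ennreal (\<bar>rh n i \<omega> - X (real i * (T / real n)) \<omega>\<bar> powr q) \<partial>M) \<le> ennreal (c * (T / real n) powr q)"
  shows "strong_order_one M T (\<lambda>n \<omega>. \<Sum>i<n. (X (real i * (T / real n)) \<omega> - rh n i \<omega>) * (T / real n))"
proof (rule strong_order_oneI)
  have diff_meas: "(\<lambda>\<omega>. X (real i * (T / real n)) \<omega> - rh n i \<omega>) \<in> borel_measurable M" if "i < n" for i n
    using grid_mem[of T i n] T_pos that by (intro borel_measurable_diff X_measurable rh_meas) auto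
  then show "(\<lambda>\<omega>. \<Sum>i<n. (X (real i * (T / real n)) \<omega> - rh n i \<omega>) * (T / real n)) \<in> borel_measurable M" for n
    by (intro borel_measurable_sum borel_measurable_times) auto
  fix m :: nat assume m: "m > 0"
  then have "real (2 * m) \<ge> 1" by simp
  from rh_err[OF this] obtain c where c: "\<And>n i. n \<ge> 1 \<Longrightarrow> i \<in> {1..n} \<Longrightarrow>
      (\<integral>\<^sup>+ \<omega>. ennreal (\<bar>rh n i \<omega> - X (real i * (T / real n)) \<omega>\<bar> powr real (2 * m)) \<partial>M) \<le> ennreal (c * (T / real n) powr real (2 * m))"
    by blast
  \<comment> \<open>The constant c comes without a sign, while the bounds that follow call for a
    nonnegative one.\<close>
  define c' where "c' = max c 0"
  have "(\<integral>\<^sup>+ \<omega>. ennreal ((\<Sum>i<n. (X (real i * (T / real n)) \<omega> - rh n i \<omega>) * (T / real n)) ^ (2 * m)) \<partial>M)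
      \<le> ennreal (T ^ (2 * m) * c' * (T / real n) ^ (2 * m))" if n: "n > 0" for n
  proof -
    have h: "T / real n > 0" using n T_pos by simp
    have "(\<integral>\<^sup>+ \<omega>. ennreal ((\<Sum>i<n. (X (real i * (T / real n)) \<omega> - rh n i \<omega>) * (T / real n)) ^ (2 * m)) \<partial>M)
      \<le> ennreal (T ^ (2 * m) * (c' * (T / real n) ^ (2 * m)))"
    proof (rule nn_moment_average[OF diff_meas _ m])
      fix i assume i: "i < n"
      show "(\<integral>\<^sup>+ \<omega>. ennreal ((X (real i * (T / real n)) \<omega> - rh n i \<omega>) ^ (2 * m)) \<partial>M) \<le> ennreal (c' * (T / real n) ^ (2 * m))"
      proof (cases "i = 0")
        case True
        have "(\<integral>\<^sup>+ \<omega>. ennreal ((X (real i * (T / real n)) \<omega> - rh n i \<omega>) ^ (2 * m)) \<partial>M) = (\<integral>\<^sup>+ \<omega>. 0 \<partial>M)"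
          using m by (intro nn_integral_cong) (simp add: True rh_init zero_power)
        then show ?thesis by simp
      next
        case False
        have "(\<integral>\<^sup>+ \<omega>. ennreal ((X (real i * (T / real n)) \<omega> - rh n i \<omega>) ^ (2 * m)) \<partial>M)
            = (\<integral>\<^sup>+ \<omega>. ennreal (\<bar>rh n i \<omega> - X (real i * (T / real n)) \<omega>\<bar> powr real (2 * m)) \<partial>M)"
          by (intro nn_integral_cong) (simp only: abs_powr_even[OF m, symmetric] abs_minus_commute)
        also have "\<dots> \<le> ennreal (c * (T / real n) powr real (2 * m))"
          using False i by (intro c) auto
        also have "\<dots> \<le> ennreal (c' * (T / real n) ^ (2 * m))"
          using h by (subst powr_realpow) (auto intro!: ennreal_leI mult_right_mono simp: c'_def)
        finally show ?thesis .
      qed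
    qed (use h in \<open>auto simp: c'_def\<close>)
    then show ?thesis by (simp only: mult.assoc)
  qed
  moreover have "T ^ (2 * m) * c' \<ge> 0" by (simp add: c'_def)
  ultimately show "\<exists>C\<ge>0. \<forall>n>0. (\<integral>\<^sup>+ \<omega>. ennreal ((\<Sum>i<n. (X (real i * (T / real n)) \<omega> - rh n i \<omega>) * (T / real n)) ^ (2 * m)) \<partial>M)
      \<le> ennreal (C * (T / real n) ^ (2 * m))"
    by blast
qed

theorem theorem1:
  fixes M :: "'a measure" and F :: "real \<Rightarrow> 'a measure"
    and W1 W2 W3 S V r :: "real \<Rightarrow> 'a \<Rightarrow> real"
    and N :: "'a \<Rightarrow> real"
    and \<mu> \<phi> :: "real \<Rightarrow> real \<Rightarrow> real"
    and rh :: "nat \<Rightarrow> nat \<Rightarrow> 'a \<Rightarrow> real"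
    and T k \<theta> \<sigma> \<rho> S0 V0 :: real
  assumes prob: "prob_space M" and filt: "is_filtration M F"
    and T_pos: "T > 0"
    and params: "k > 0" "\<theta> > 0" "\<sigma> > 0" "-1 \<le> \<rho>" "\<rho> \<le> 1" "S0 > 0" "V0 > 0"
    and BM: "is_BM M F T W1" "is_BM M F T W2" "is_BM M F T W3"
    and indep12: "prob_space.indep_set M (gen_sigma M (W1 ` {0..T})) (gen_sigma M (W2 ` {0..T}))"
    and indep3: "prob_space.indep_set M (gen_sigma M (W1 ` {0..T} \<union> W2 ` {0..T})) (gen_sigma M (W3 ` {0..T}))"
    and S_init: "\<forall>\<omega>\<in>space M. S 0 \<omega> = S0"
    and S_sde: "adapted_proc F T S \<and> cont_paths M T S \<and>
       (\<forall>t\<in>{0..T}. ito_integral_is M (\<lambda>u \<omega>. sqrt (V u \<omega>) * S u \<omega>)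
          (\<lambda>u \<omega>. \<rho> * W1 u \<omega> + sqrt (1 - \<rho>\<^sup>2) * W2 u \<omega>) 0 t
          (\<lambda>\<omega>. S t \<omega> - S 0 \<omega> - integral {0..t} (\<lambda>u. r u \<omega> * S u \<omega>)))"
    and V_init: "\<forall>\<omega>\<in>space M. V 0 \<omega> = V0"
    and V_nonneg: "\<forall>t\<in>{0..T}. \<forall>\<omega>\<in>space M. V t \<omega> \<ge> 0"
    and V_sde: "sde_solution M F T (\<lambda>t x. k * (\<theta> - x)) (\<lambda>t x. \<sigma> * sqrt x) W1 V"
    and mu_cont: "continuous_on ({0..T} \<times> UNIV) (\<lambda>(t, x). \<mu> t x)"
    and phi_cont: "continuous_on ({0..T} \<times> UNIV) (\<lambda>(t, x). \<phi> t x)"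
    and r_sde: "sde_solution M F T \<mu> \<phi> W3 r"
    and r_unique: "\<And>r'. sde_solution M F T \<mu> \<phi> W3 r' \<Longrightarrow>
        (AE \<omega> in M. r' 0 \<omega> = r 0 \<omega>) \<Longrightarrow> (\<forall>t\<in>{0..T}. AE \<omega> in M. r' t \<omega> = r t \<omega>)"
    and N_normal: "distributed M lborel N std_normal_density"
    and N_indep: "prob_space.indep_set M (gen_sigma M {N}) (gen_sigma M (V ` {0..T} \<union> r ` {0..T}))"
    and X_repr: "AE \<omega> in M. ln (S T \<omega>) = ln S0 + integral {0..T} (\<lambda>t. r t \<omega>)
        + (\<rho> * k / \<sigma> - 1/2) * integral {0..T} (\<lambda>t. V t \<omega>)
        + \<rho> / \<sigma> * (V T \<omega> - V0 - k * \<theta> * T)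
        + sqrt (1 - \<rho>\<^sup>2) * sqrt (integral {0..T} (\<lambda>t. V t \<omega>)) * N \<omega>"
    and mu_mom: "\<And>q. q \<ge> 1 \<Longrightarrow>
        (SUP t\<in>{0..T}. \<integral>\<^sup>+ \<omega>. ennreal (\<bar>\<mu> t (r t \<omega>)\<bar> powr q) \<partial>M) < \<infinity>"
    and phi_mom: "\<And>q. q \<ge> 1 \<Longrightarrow>
        (SUP t\<in>{0..T}. \<integral>\<^sup>+ \<omega>. ennreal (\<bar>\<phi> t (r t \<omega>)\<bar> powr q) \<partial>M) < \<infinity>"
    and rh_meas: "\<And>n i. rh n i \<in> borel_measurable M"
    and rh_init: "\<And>n. \<forall>\<omega>\<in>space M. rh n 0 \<omega> = r 0 \<omega>"
    and rh_err: "\<And>q. q \<ge> 1 \<Longrightarrow> \<exists>c. \<forall>n\<ge>1. \<forall>i\<in>{1..n}.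
        (\<integral>\<^sup>+ \<omega>. ennreal (\<bar>rh n i \<omega> - r (real i * (T / real n)) \<omega>\<bar> powr q) \<partial>M)
          \<le> ennreal (c * (T / real n) powr q)"
  shows "\<forall>q\<ge>2. \<exists>C. eventually (\<lambda>n::nat.
      (\<integral>\<^sup>+ \<omega>. ennreal (\<bar>ln (S T \<omega>) -
          (ln S0 + (\<Sum>i<n. rh n i \<omega> * (T / real n))
           + (\<rho> * k / \<sigma> - 1/2) * (\<Sum>i<n. V (real i * (T / real n)) \<omega> * (T / real n))
           + \<rho> / \<sigma> * (V T \<omega> - V0 - k * \<theta> * T)
           + sqrt (1 - \<rho>\<^sup>2) * sqrt (\<Sum>i<n. V (real i * (T / real n)) \<omega> * (T / real n)) * N \<omega>)\<bar>
          powr q) \<partial>M)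
      \<le> ennreal (C * (T / real n) powr q)) sequentially"
proof (intro allI impI)
  fix q :: real assume q: "2 \<le> q"
  interpret prob_space M by (rule prob)
  interpret vol: cir M F T k \<theta> \<sigma> W1 V V0
  proof unfold_locales
    show "continuous_on ({0..T} \<times> UNIV) (\<lambda>(t, x). k * (\<theta> - x))"
      "continuous_on ({0..T} \<times> UNIV) (\<lambda>(t, x). \<sigma> * sqrt x)"
      unfolding case_prod_beta by (intro continuous_intros)+
  qed (use filt BM T_pos V_sde params V_init V_nonneg in auto)
  interpret rate: sde M F T \<mu> \<phi> W3 r
    by unfold_locales (use filt BM T_pos r_sde mu_cont phi_cont in auto)
  have moments: "\<exists>K\<ge>0. \<forall>t\<in>{0..T}. (\<integral>\<^sup>+ \<omega>. ennreal (f t (r t \<omega>) ^ (2 * m)) \<partial>M) \<le> ennreal K"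
    if "m > 0" and "\<And>q. q \<ge> 1 \<Longrightarrow> (SUP t\<in>{0..T}. \<integral>\<^sup>+ \<omega>. ennreal (\<bar>f t (r t \<omega>)\<bar> powr q) \<partial>M) < \<infinity>" for f m
    using nn_integral_SUP_bound[OF that(2)[of "real (2 * m)"]] that(1) by (simp only: abs_powr_even[OF that(1)])
  \<comment> \<open>The signed error, with one summand for each source: quadrature of r,
    approximation of r, quadrature of V, square root. The terms with \<open>V T\<close> cancel
    because the scheme uses the exact value.\<close>
  define E where "E = (\<lambda>n \<omega>.
      (integral {0..T} (\<lambda>t. r t \<omega>) - (\<Sum>i<n. r (real i * (T / real n)) \<omega> * (T / real n)))
    + (\<Sum>i<n. (r (real i * (T / real n)) \<omega> - rh n i \<omega>) * (T / real n))
    + (\<rho> * k / \<sigma> - 1/2) * (integral {0..T} (\<lambda>t. V t \<omega>) - (\<Sum>i<n. V (real i * (T / real n)) \<omega> * (T / real n)))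
    + sqrt (1 - \<rho>\<^sup>2) * ((sqrt (integral {0..T} (\<lambda>t. V t \<omega>))
        - sqrt (\<Sum>i<n. V (real i * (T / real n)) \<omega> * (T / real n))) * N \<omega>))"
  have "strong_order_one M T E"
    unfolding E_def
    by (intro strong_order_one_add strong_order_one_cmult rate.quadrature_order_one rate.approximation_order_one
        vol.variance_quadrature_order_one vol.volatility_order_one N_normal moments mu_mom phi_mom rh_meas rh_err)
      (use rh_init in auto)
  then obtain C where C: "\<And>n. n > 0 \<Longrightarrow> (\<integral>\<^sup>+ \<omega>. ennreal (\<bar>E n \<omega>\<bar> powr q) \<partial>M) \<le> ennreal (C * (T / real n) powr q)"
    using strong_order_one_powr[of T E q] T_pos q by auto
  show "\<exists>C. eventually (\<lambda>n::nat.
      (\<integral>\<^sup>+ \<omega>. ennreal (\<bar>ln (S T \<omega>) -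
          (ln S0 + (\<Sum>i<n. rh n i \<omega> * (T / real n))
           + (\<rho> * k / \<sigma> - 1/2) * (\<Sum>i<n. V (real i * (T / real n)) \<omega> * (T / real n))
           + \<rho> / \<sigma> * (V T \<omega> - V0 - k * \<theta> * T)
           + sqrt (1 - \<rho>\<^sup>2) * sqrt (\<Sum>i<n. V (real i * (T / real n)) \<omega> * (T / real n)) * N \<omega>)\<bar>
          powr q) \<partial>M)
      \<le> ennreal (C * (T / real n) powr q)) sequentially"
  proof (intro exI[of _ C] eventually_mono[OF eventually_gt_at_top[of 0]])
    fix n :: nat assume n: "0 < n"
    have "(\<integral>\<^sup>+ \<omega>. ennreal (\<bar>ln (S T \<omega>) -
          (ln S0 + (\<Sum>i<n. rh n i \<omega> * (T / real n))
           + (\<rho> * k / \<sigma> - 1/2) * (\<Sum>i<n. V (real i * (T / real n)) \<omega> * (T / real n))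
           + \<rho> / \<sigma> * (V T \<omega> - V0 - k * \<theta> * T)
           + sqrt (1 - \<rho>\<^sup>2) * sqrt (\<Sum>i<n. V (real i * (T / real n)) \<omega> * (T / real n)) * N \<omega>)\<bar>
          powr q) \<partial>M) = (\<integral>\<^sup>+ \<omega>. ennreal (\<bar>E n \<omega>\<bar> powr q) \<partial>M)"
    \<comment> \<open>The representation of \<open>ln (S T \<omega>)\<close> holds almost surely, so
      the integrands are compared up to a null set.\<close>
    proof (rule nn_integral_cong_AE, use X_repr in eventually_elim)
      case (elim \<omega>)
      have sums: "(\<Sum>i<n. (r (real i * (T / real n)) \<omega> - rh n i \<omega>) * (T / real n))
          = (\<Sum>i<n. r (real i * (T / real n)) \<omega> * (T / real n)) - (\<Sum>i<n. rh n i \<omega> * (T / real n))"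
        by (simp only: left_diff_distrib sum_subtractf)
      \<comment> \<open>Stated for free real variables, so that sums and integrals stay opaque to
        the simplifier; \<open>x''\<close> stands for the Riemann sum of the exact rate.\<close>
      have "l + x + c * y + d + e * u * v - (l + x' + c * y' + d + e * u' * v)
          = x - x'' + (x'' - x') + c * (y - y') + e * ((u - u') * v)" for l x x' x'' c y y' d e u u' v :: real
        by (simp add: algebra_simps)
      note decomp = this
      show ?case
        unfolding elim E_def sums by (intro arg_cong[where f = "\<lambda>x. ennreal (\<bar>x\<bar> powr q)"] decomp)
    qed
    then show "(\<integral>\<^sup>+ \<omega>. ennreal (\<bar>ln (S T \<omega>) -
          (ln S0 + (\<Sum>i<n. rh n i \<omega> * (T / real n))
           + (\<rho> * k / \<sigma> - 1/2) * (\<Sum>i<n. V (real i * (T / real n)) \<omega> * (T / real n))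
           + \<rho> / \<sigma> * (V T \<omega> - V0 - k * \<theta> * T)
           + sqrt (1 - \<rho>\<^sup>2) * sqrt (\<Sum>i<n. V (real i * (T / real n)) \<omega> * (T / real n)) * N \<omega>)\<bar>
          powr q) \<partial>M) \<le> ennreal (C * (T / real n) powr q)"
      using C[OF n] by simp
  qed
qed

end
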